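(* Let $u\in\mathrm{Lip}(\mathbf{T}^N)$ and, for each $n$, let $u_n=u*\eta_n\in C^\infty(\mathbf{T}^N)$ be its standard mollification. If a sequence $(x_n,p_n)$ with $(x_n,p_n)\in\nabla u_n$ for each $n$ converges to $(x,p)\in\mathbf{T}^N\times\mathbf{R}^N$, then $(x,p)\in\partial u$.
   Context: $\mathbf{T}^N=\mathbf{R}^N/\mathbf{Z}^N$ is the flat torus, and $\mathrm{Lip}(\mathbf{T}^N)$ is the set of real-valued Lipschitz continuous functions on $\mathbf{T}^N$; functions on $\mathbf{T}^N$ are regarded as $\mathbf{Z}^N$-periodic functions on $\mathbf{R}^N$ when writing $y-x$ or convolutions. For $u\colon\mathbf{T}^N\to\mathbf{R}$, the graph of classical gradients is $$\nabla u=\{(x,p)\in\mathbf{T}^N\times\mathbf{R}^N \mid u(y)=u(x)+p\cdot(y-x)+o(|y-x|)\text{ as }y\to x\}.$$ For $u\in\mathrm{Lip}(\mathbf{T}^N)$, the (Clarke) generalized gradient is the set $\partial u\subset\mathbf{T}^N\times\mathbf{R}^N$ obtained by taking the closure $\overline{\nabla u}$ of $\nabla u$ in $\mathbf{T}^N\times\mathbf{R}^N$ and then the closed convex hull with respect to $p$: for each $x$, $\partial u(x)=\{p\mid(x,p)\in\partial u\}$ is the closed convex hull of $\{p\mid(x,p)\in\overline{\nabla u}\}$. The standard (Friedrichs) mollifier is $\eta_n(y)=n^N\eta(ny)$, $n=1,2,\dots$, where $\eta\in C^\infty(\mathbf{R}^N)$ is a fixed nonnegative radially symmetric function supported in the closed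 unit ball with $\int\eta=1$, and $(u*\eta_n)(x)=\int u(x-y)\eta_n(y)\,dy$. *)

theory Defs
  imports "HOL-Analysis.Analysis" "HOL-Library.Landau_Symbols"
begin

section \<open>The flat torus\<close>

definition torus_rel :: "real ^ 'n \<Rightarrow> real ^ 'n \<Rightarrow> bool" where
  "torus_rel x y \<longleftrightarrow> (\<forall>i. x $ i - y $ i \<in> \<int>)"

lemma equivp_torus_rel: "equivp torus_rel"
proof (rule equivpI)
  show "reflp torus_rel"
    by (simp add: reflp_def torus_rel_def)
  show "symp torus_rel"
    unfolding symp_def torus_rel_def by (metis Ints_minus minus_diff_eq)
  show "transp torus_rel"
    unfolding transp_def torus_rel_def
  proof (intro allI impI)
    fix x y z :: "real ^ 'n" and i
    assume "\<forall>i. x $ i - y $ i \<in> \<int>" "\<forall>i. y $ i - z $ i \<in> \<int>"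
    then have "(x $ i - y $ i) + (y $ i - z $ i) \<in> \<int>"
      by (intro Ints_add) auto
    then show "x $ i - z $ i \<in> \<int>" by simp
  qed
qed

quotient_type (overloaded) 'n torus = "real ^ 'n::finite" / torus_rel
  by (rule equivp_torus_rel)

lift_definition to_torus :: "real ^ 'n::finite \<Rightarrow> 'n torus" is "\<lambda>x. x" .

lemma to_torus_surj: "\<exists>x. to_torus x = X"
  by transfer (rule exI, rule equivp_reflp[OF equivp_torus_rel])

lemma to_torus_eq_iff: "to_torus x = to_torus y \<longleftrightarrow> (\<forall>i. x $ i - y $ i \<in> \<int>)"
  by transfer (simp add: torus_rel_def)

instantiation torus :: (finite) ab_group_add
begin

lift_definition zero_torus :: "'a torus" is 0 .

lift_definition plus_torus :: "'a torus \<Rightarrow> 'a torus \<Rightarrow> 'a torus" is "(+)"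
proof -
  fix a b c d :: "real ^ 'a"
  assume "torus_rel a b" "torus_rel c d"
  then have "(a $ i - b $ i) + (c $ i - d $ i) \<in> \<int>" for i
    unfolding torus_rel_def by (blast intro: Ints_add)
  then show "torus_rel (a + c) (b + d)"
    by (simp add: torus_rel_def add_diff_add)
qed

lift_definition uminus_torus :: "'a torus \<Rightarrow> 'a torus" is uminus
proof -
  fix a b :: "real ^ 'a"
  assume "torus_rel a b"
  then have "- (a $ i - b $ i) \<in> \<int>" for i
    by (intro Ints_minus) (simp add: torus_rel_def)
  then show "torus_rel (- a) (- b)"
    by (simp add: torus_rel_def)
qed

lift_definition minus_torus :: "'a torus \<Rightarrow> 'a torus \<Rightarrow> 'a torus" is "(-)"
proof -
  fix a b c d :: "real ^ 'a"
  assume "torus_rel a b" "torus_rel c d"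
  then have "(a $ i - b $ i) - (c $ i - d $ i) \<in> \<int>" for i
    unfolding torus_rel_def by (blast intro: Ints_diff)
  moreover have "(a - c) $ i - (b - d) $ i = (a $ i - b $ i) - (c $ i - d $ i)" for i
    by simp
  ultimately show "torus_rel (a - c) (b - d)"
    unfolding torus_rel_def by metis
qed

instance
proof
  fix a b c :: "'a torus"
  show "a + b + c = a + (b + c)"
    by transfer (simp add: torus_rel_def)
  show "a + b = b + a"
    by transfer (simp add: torus_rel_def)
  show "0 + a = a"
    by transfer (simp add: torus_rel_def)
  show "- a + a = 0"
    by transfer (simp add: torus_rel_def)
  show "a - b = a + - b"
    by transfer (simp add: torus_rel_def)
qed

end

lemma to_torus_zero: "to_torus 0 = 0"
  by (transfer, simp add: torus_rel_def)

lemma to_torus_add: "to_torus (x + y) = to_torus x + to_torus y"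
  by (transfer, simp add: torus_rel_def)

lemma to_torus_minus: "to_torus (- x) = - to_torus x"
  by (transfer, simp add: torus_rel_def)

lemma to_torus_diff: "to_torus (x - y) = to_torus x - to_torus y"
  by (transfer, simp add: torus_rel_def)

lemma to_torus_norm_small_eq:
  assumes "to_torus z = to_torus w" "norm z < 1 / 2" "norm w < 1 / 2"
  shows "z = w"
proof (simp only: vec_eq_iff, intro allI)
  fix i
  have "z $ i - w $ i \<in> \<int>" using assms(1) by (simp add: to_torus_eq_iff)
  moreover have "\<bar>z $ i - w $ i\<bar> < 1"
    using component_le_norm_cart[of z i] component_le_norm_cart[of w i] assms by linarith
  ultimately show "z $ i = w $ i"
    using Ints_nonzero_abs_ge1 by fastforce
qed

text \<open>The flat metric: the distance of two points is the infimum of the Euclidean lengths of the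
  vectors that translate one point to the other, i.e. \<open>inf {|x - y + k| : k \<in> Z\<^sup>N}\<close>.\<close>

instantiation torus :: (finite) metric_space
begin

definition dist_torus :: "'a torus \<Rightarrow> 'a torus \<Rightarrow> real" where
  "dist_torus X Y = (INF z\<in>{z. to_torus z = X - Y}. norm z)"

definition uniformity_torus :: "('a torus \<times> 'a torus) filter" where
  "uniformity_torus = (INF e\<in>{0<..}. principal {(x, y). dist x y < e})"

definition open_torus :: "'a torus set \<Rightarrow> bool" where
  "open_torus U \<longleftrightarrow> (\<forall>x\<in>U. eventually (\<lambda>(x', y). x' = x \<longrightarrow> y \<in> U) uniformity)"

instance
proof
  have bdd: "bdd_below (norm ` A)" for A :: "(real ^ 'a) set"
    by (rule bdd_belowI[of _ 0]) auto
  have ne: "{z. to_torus z = X} \<noteq> {}" for X :: "'a torus"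
    using to_torus_surj by auto
  have less: "(dist X Y < e) \<longleftrightarrow> (\<exists>z. to_torus z = X - Y \<and> norm z < e)"
    for X Y :: "'a torus" and e
    unfolding dist_torus_def by (subst cINF_less_iff[OF ne bdd]) auto
  have nonneg: "dist X Y \<ge> 0" for X Y :: "'a torus"
    unfolding dist_torus_def by (intro cINF_greatest[OF ne]) auto
  have comm: "dist X Y \<le> dist Y X" for X Y :: "'a torus"
  proof (rule dense_ge)
    fix e assume "dist Y X < e"
    then obtain z where "to_torus z = Y - X" "norm z < e" by (auto simp: less)
    then have "to_torus (- z) = X - Y" "norm (- z) < e" by (simp_all add: to_torus_minus)
    then show "dist X Y \<le> e" using less order_less_imp_le by blast
  qed
  show "dist X Y = 0 \<longleftrightarrow> X = Y" for X Y :: "'a torus"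
  proof
    assume d: "dist X Y = 0"
    then have ex: "\<exists>z. to_torus z = X - Y \<and> norm z < e" if "e > 0" for e
      using less[of X Y e] that by simp
    obtain z where z: "to_torus z = X - Y" "norm z < 1 / 2" using ex[of "1 / 2"] by auto
    have "z = 0"
    proof (rule ccontr)
      assume "z \<noteq> 0"
      then obtain w where w: "to_torus w = X - Y" "norm w < norm z"
        using ex[of "norm z"] by auto
      then have "w = z" using z by (intro to_torus_norm_small_eq) auto
      then show False using w by simp
    qed
    then show "X = Y" using z(1) by (simp add: to_torus_zero)
  next
    assume "X = Y"
    then have "dist X Y < e" if "e > 0" for e
      using that by (auto simp: less intro!: exI[of _ 0] to_torus_zero)
    then show "dist X Y = 0" using nonneg[of X Y] by (meson less_irrefl not_le order_le_less)
  qed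
  show "dist X Y \<le> dist X Z + dist Y Z" for X Y Z :: "'a torus"
  proof (rule field_le_epsilon)
    fix e :: real assume "e > 0"
    then have "dist X Z < dist X Z + e / 2" "dist Z Y < dist Y Z + e / 2"
      using comm[of Z Y] by auto
    then obtain z w where "to_torus z = X - Z" "norm z < dist X Z + e / 2"
      "to_torus w = Z - Y" "norm w < dist Y Z + e / 2"
      unfolding less by auto
    then have "to_torus (z + w) = X - Y" "norm (z + w) < dist X Z + dist Y Z + e"
      using norm_triangle_ineq[of z w] by (auto simp: to_torus_add)
    then show "dist X Y \<le> dist X Z + dist Y Z + e"
      using less order_less_imp_le by blast
  qed
qed (rule uniformity_torus_def, rule open_torus_def)

end

lemma dist_torus_less_iff: "dist X Y < e \<longleftrightarrow> (\<exists>z. to_torus z = X - Y \<and> norm z < e)"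
proof -
  have "{z. to_torus z = X - Y} \<noteq> {}" using to_torus_surj by auto
  moreover have "bdd_below (norm ` {z. to_torus z = X - Y})"
    by (rule bdd_belowI[of _ 0]) auto
  ultimately show ?thesis
    unfolding dist_torus_def by (subst cINF_less_iff) auto
qed

text \<open>The metric topology is the quotient topology.\<close>

lemma open_torus_iff_quotient:
  fixes U :: "'n::finite torus set"
  shows "open U \<longleftrightarrow> open (to_torus -` U)"
proof
  assume U: "open U"
  show "open (to_torus -` U)"
    unfolding open_dist
  proof
    fix x assume "x \<in> to_torus -` U"
    then obtain e where e: "e > 0" "\<And>Y. dist Y (to_torus x) < e \<Longrightarrow> Y \<in> U"
      using U unfolding open_dist by auto
    have "to_torus y \<in> U" if "dist y x < e" for y
      by (rule e(2)) (use that in \<open>auto simp: dist_torus_less_iff dist_norm to_torus_diff intro!: exI[of _ "y - x"]\<close>)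
    then show "\<exists>e>0. \<forall>y. dist y x < e \<longrightarrow> y \<in> to_torus -` U" using e(1) by auto
  qed
next
  assume U: "open (to_torus -` U)"
  show "open U"
    unfolding open_dist
  proof
    fix X assume X: "X \<in> U"
    obtain x where x: "to_torus x = X" using to_torus_surj by auto
    then obtain e where e: "e > 0" "\<And>y. dist y x < e \<Longrightarrow> to_torus y \<in> U"
      using U X unfolding open_dist by auto
    have "Y \<in> U" if Y: "dist Y X < e" for Y
    proof -
      obtain z where z: "to_torus z = Y - X" "norm z < e"
        using Y unfolding dist_torus_less_iff by blast
      then have "to_torus (x + z) \<in> U" by (intro e(2)) (simp add: dist_norm)
      then show ?thesis using x z by (simp add: to_torus_add)
    qed
    then show "\<exists>e>0. \<forall>Y. dist Y X < e \<longrightarrow> Y \<in> U" using e(1) by auto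
  qed
qed

section \<open>Gradients\<close>

definition Lip :: "('n::finite torus \<Rightarrow> real) set" where
  "Lip = {u. \<exists>L. L-lipschitz_on UNIV u}"

text \<open>A function on the torus is lifted to the periodic function \<open>y \<mapsto> u (to_torus y)\<close>; by periodicity
  the expansion at \<open>x\<close> does not depend on the lift \<open>x\<close> of the base point.\<close>

definition grad_graph :: "('n::finite torus \<Rightarrow> real) \<Rightarrow> ('n torus \<times> (real ^ 'n)) set" where
  "grad_graph u = {(to_torus x, p) | x p.
     (\<lambda>y. u (to_torus y) - u (to_torus x) - p \<bullet> (y - x)) \<in> o[at x](\<lambda>y. norm (y - x))}"

definition clarke_gradient :: "('n::finite torus \<Rightarrow> real) \<Rightarrow> ('n torus \<times> (real ^ 'n)) set" where
  "clarke_gradient u = {(x, p). p \<in> closure (convex hull {q. (x, q) \<in> closure (grad_graph u)})}"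

section \<open>Mollification\<close>

text \<open>On a finite-dimensional domain, continuity of all iterated directional derivatives is
  continuity of the iterated total derivatives, so \<open>C_k\<close> is the usual class.\<close>

primrec C_k :: "nat \<Rightarrow> ('a::euclidean_space \<Rightarrow> 'b::real_normed_vector) \<Rightarrow> bool" where
  "C_k 0 f \<longleftrightarrow> continuous_on UNIV f"
| "C_k (Suc k) f \<longleftrightarrow> (\<forall>x. f differentiable (at x)) \<and>
     (\<forall>v. C_k k (\<lambda>x. frechet_derivative f (at x) v))"

definition C_infinity :: "('a::euclidean_space \<Rightarrow> 'b::real_normed_vector) \<Rightarrow> bool" where
  "C_infinity f \<longleftrightarrow> (\<forall>k. C_k k f)"

definition friedrichs_kernel :: "(real ^ 'n::finite \<Rightarrow> real) \<Rightarrow> bool" where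
  "friedrichs_kernel \<eta> \<longleftrightarrow>
     C_infinity \<eta> \<and> (\<forall>y. 0 \<le> \<eta> y) \<and> (\<forall>y z. norm y = norm z \<longrightarrow> \<eta> y = \<eta> z) \<and>
     closure {y. \<eta> y \<noteq> 0} \<subseteq> cball 0 1 \<and> integral\<^sup>L lborel \<eta> = 1"

definition mollifier :: "(real ^ 'n::finite \<Rightarrow> real) \<Rightarrow> nat \<Rightarrow> real ^ 'n \<Rightarrow> real" where
  "mollifier \<eta> n y = real n ^ CARD('n) * \<eta> (real n *\<^sub>R y)"

definition torus_convolution ::
    "('n::finite torus \<Rightarrow> real) \<Rightarrow> (real ^ 'n \<Rightarrow> real) \<Rightarrow> 'n torus \<Rightarrow> real" where
  "torus_convolution u \<phi> X = (LINT y|lborel. u (X - to_torus y) * \<phi> y)"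

end

theory Submission
  imports Defs
begin

text \<open>If \<open>p0\<close> were outside the closed convex hull, a vector \<open>v\<close> and a number \<open>b\<close>
  would separate it from the hull; by compactness all gradients \<open>q\<close> of \<open>u\<close> at points near \<open>x0\<close> then satisfy \<open>v \<bullet> q \<ge> b\<close>. By
  Rademacher's theorem and dominated convergence a gradient of the mollified function is an average
  of gradients of \<open>u\<close> at nearby points, so it satisfies the same bound, which passes to the limit
  \<open>p0\<close>. Rademacher's theorem rests on a Vitali covering argument on the real line, Fubini for
  directional derivatives, and the almost everywhere additivity of the directional derivative.\<close>

section \<open>Lipschitz functions on the real line\<close>

text \<open>Testing the hull against a single vector \<open>v\<close> means that only the scalar
  directional derivative along \<open>v\<close> is integrated, so no measurable choice of the full
  gradient has to be made. The averaging needs gradients of \<open>u\<close> at almost every point,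
  which is why Rademacher's theorem carries most of the work. On the line the increment
  \<open>f b - f a\<close> has no sign and is not the value of a measure; adding a multiple of the
  identity makes the function monotone, so that increments become values of a Stieltjes measure to
  which a covering argument applies. In higher dimension the obstacle is linearity: each direction
  has its own exceptional null set. Linearity is therefore established on a countable dense set of
  directions, and the Lipschitz bound, uniform in the direction, extends the expansion to all of
  them.\<close>

text \<open>Disjoint balls from the fine cover exhaust \<open>E\<close> up to a null set and lie in
  an open set that exceeds \<open>E\<close> by little Lebesgue measure. Summing the estimates on the
  balls gives the bound for their union, and \<open>upper\<close> controls the excess. The balls
  need only contain \<open>x\<close>, not be centred there, because the intervals to which this is
  applied have no preferred centre.\<close>

lemma Vitali_measure_lower_bound:
  fixes M :: "'a::euclidean_space measure"
  assumes sets_M: "sets M = sets borel"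
    and upper: "\<And>A. A \<in> sets borel \<Longrightarrow> emeasure M A \<le> ennreal L * emeasure lborel A"
    and E: "E \<in> sets borel"
    and fine: "\<And>x d. \<lbrakk>x \<in> E; 0 < d\<rbrakk> \<Longrightarrow> \<exists>a r. x \<in> cball a r \<and> 0 < r \<and> r < d \<and>
                 ennreal q * emeasure lborel (cball a r) \<le> emeasure M (cball a r)"
  shows "ennreal q * emeasure lborel E \<le> emeasure M E"
proof -
  have approx: "ennreal q * emeasure lborel E \<le> emeasure M E + ennreal L * ennreal e"
    if "e > 0" for e :: real
  proof -
    obtain U where U: "open U" "E \<subseteq> U" "emeasure lborel (U - E) < e"
      using outer_regular_lborel[OF E \<open>e > 0\<close>] by blast
    define K where "K = {(a, r). 0 < r \<and> cball a r \<subseteq> U \<and>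
      ennreal q * emeasure lborel (cball a r) \<le> emeasure M (cball a r)}"
    have K_pos: "0 < snd i" if "i \<in> K" for i
      using that by (auto simp: K_def)
    have "\<exists>i. i \<in> K \<and> x \<in> cball (fst i) (snd i) \<and> snd i < d" if "x \<in> E" "0 < d" for x d
    proof -
      obtain s where s: "s > 0" "ball x s \<subseteq> U"
        using U \<open>x \<in> E\<close> by (meson open_contains_ball subsetD)
      obtain a r where ar: "x \<in> cball a r" "0 < r" "r < min d (s / 2)"
        "ennreal q * emeasure lborel (cball a r) \<le> emeasure M (cball a r)"
        using fine[OF \<open>x \<in> E\<close>, of "min d (s / 2)"] s \<open>0 < d\<close> by auto
      have "cball a r \<subseteq> ball x s"
      proof
        fix y assume "y \<in> cball a r"
        then show "y \<in> ball x s"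
          using ar(1,3) dist_triangle[of x y a] by (simp add: dist_commute)
      qed
      with ar s show ?thesis
        by (intro exI[of _ "(a, r)"]) (auto simp: K_def)
    qed
    then have fineK: "\<And>x d. \<lbrakk>x \<in> E; 0 < d\<rbrakk> \<Longrightarrow> \<exists>i. i \<in> K \<and> x \<in> cball (fst i) (snd i) \<and> snd i < d" .
    obtain C where C: "countable C" "C \<subseteq> K"
        "pairwise (\<lambda>i j. disjnt (cball (fst i) (snd i)) (cball (fst j) (snd j))) C"
        "negligible (E - (\<Union>i\<in>C. cball (fst i) (snd i)))"
      by (rule Vitali_covering_theorem_cballs[OF K_pos fineK])
    let ?B = "\<lambda>i. cball (fst i) (snd i)"
    let ?W = "\<Union>(?B ` C)"
    have disj: "disjoint_family_on ?B C"
      using C(3) by (auto simp: disjoint_family_on_def pairwise_def disjnt_def)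
    have W: "?W \<in> sets borel"
      using C(1) by (intro sets.countable_UN') auto
    have "emeasure lborel (E - ?W) = 0"
    proof -
      have "E - ?W \<in> sets borel" using E W by auto
      then show ?thesis
        using C(4) by (simp add: negligible_iff_emeasure0 emeasure_completion)
    qed
    moreover have "emeasure lborel E \<le> emeasure lborel (?W \<union> (E - ?W))"
      using E W by (intro emeasure_mono) auto
    moreover have "\<dots> \<le> emeasure lborel ?W + emeasure lborel (E - ?W)"
      using E W by (intro emeasure_subadditive) auto
    ultimately have "emeasure lborel E \<le> emeasure lborel ?W"
      by simp
    then have "ennreal q * emeasure lborel E \<le> ennreal q * emeasure lborel ?W"
      by (intro mult_left_mono) auto
    also have "\<dots> = ennreal q * (\<integral>\<^sup>+i. emeasure lborel (?B i) \<partial>count_space C)"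
      by (subst emeasure_UN_countable[OF _ C(1) disj]) auto
    also have "\<dots> = (\<integral>\<^sup>+i. ennreal q * emeasure lborel (?B i) \<partial>count_space C)"
      by (simp add: nn_integral_cmult)
    also have "\<dots> \<le> (\<integral>\<^sup>+i. emeasure M (?B i) \<partial>count_space C)"
      using C(2) by (intro nn_integral_mono) (auto simp: K_def)
    also have "\<dots> = emeasure M ?W"
      by (subst emeasure_UN_countable[OF _ C(1) disj]) (auto simp: sets_M)
    also have "\<dots> \<le> emeasure M (E \<union> (U - E))"
    proof -
      have "?W \<subseteq> U" using C(2) by (force simp: K_def)
      then show ?thesis using E U by (intro emeasure_mono) (auto simp: sets_M)
    qed
    also have "\<dots> \<le> emeasure M E + emeasure M (U - E)"
      using E U by (intro emeasure_subadditive) (auto simp: sets_M)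
    also have "emeasure M (U - E) \<le> ennreal L * emeasure lborel (U - E)"
      using E U by (intro upper) auto
    also have "\<dots> \<le> ennreal L * ennreal e"
      using U(3) by (intro mult_left_mono) auto
    finally show ?thesis
      by (simp add: add_left_mono)
  qed
  show ?thesis
  proof (rule ennreal_le_epsilon)
    fix e :: real assume "e > 0"
    \<comment> \<open>\<open>L\<close> is an arbitrary real, so the denominator is chosen to be
      positive and to dominate \<open>L\<close>.\<close>
    define d where "d = e / (\<bar>L\<bar> + 1)"
    have "d > 0" using \<open>e > 0\<close> by (auto simp: d_def)
    have "L * d \<le> e"
    proof -
      have "L * d \<le> (\<bar>L\<bar> + 1) * d" using \<open>d > 0\<close> by (intro mult_right_mono) auto
      then show ?thesis by (simp add: d_def)
    qed
    then have "ennreal L * ennreal d \<le> ennreal e"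
      using \<open>d > 0\<close> by (simp add: ennreal_mult''[symmetric] ennreal_leI)
    with approx[OF \<open>d > 0\<close>] show "ennreal q * emeasure lborel E \<le> emeasure M E + ennreal e"
      by (meson add_left_mono order_trans)
  qed
qed

text \<open>Lebesgue measure is determined by its values on boxes, so the sum divided by
  \<open>c\<close> only has to be evaluated on open intervals, where the increments of
  \<open>F\<close> and \<open>G\<close> add up to \<open>c * (u - l)\<close>.\<close>

lemma interval_measure_add_eq_lborel:
  fixes F G :: "real \<Rightarrow> real"
  assumes F: "\<And>x y. x \<le> y \<Longrightarrow> F x \<le> F y" "continuous_on UNIV F"
    and G: "\<And>x y. x \<le> y \<Longrightarrow> G x \<le> G y" "continuous_on UNIV G"
    and sum: "\<And>x. F x + G x = c * x" and c: "c > 0"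
    and A: "A \<in> sets borel"
  shows "emeasure (interval_measure F) A + emeasure (interval_measure G) A
    = ennreal c * emeasure lborel A"
proof -
  let ?S = "\<lambda>A. ennreal (1 / c) * (emeasure (interval_measure F) A + emeasure (interval_measure G) A)"
  define S where "S = measure_of UNIV (sets borel) ?S"
  have sets_S: "sets S = sets borel"
    unfolding S_def by (simp add: sets.sigma_sets_eq[of borel, simplified])
  have "countably_additive (sets borel) ?S"
  proof (rule countably_additiveI)
    fix B :: "nat \<Rightarrow> real set"
    assume B: "range B \<subseteq> sets borel" "disjoint_family B"
    have "(\<Sum>i. ?S (B i)) = ennreal (1 / c) *
        ((\<Sum>i. emeasure (interval_measure F) (B i)) + (\<Sum>i. emeasure (interval_measure G) (B i)))"
      by (simp only: suminf_add[OF summableI summableI] ennreal_suminf_cmult)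
    also have "\<dots> = ?S (\<Union>i. B i)"
      using B by (simp add: suminf_emeasure)
    finally show "(\<Sum>i. ?S (B i)) = ?S (\<Union>i. B i)" .
  qed
  then have em_S: "emeasure S B = ?S B" if "B \<in> sets borel" for B
    unfolding S_def using that
    by (intro emeasure_measure_of[where \<Omega>=UNIV and A="sets borel"])
      (auto simp: positive_def sets.sigma_sets_eq[of borel, simplified])
  \<comment> \<open>Continuity makes every single point a null set, so open and closed intervals
    have the same measure.\<close>
  have Ioo: "emeasure (interval_measure H) {l<..<u} = H u - H l"
    if "l \<le> u" and H: "\<And>x y. x \<le> y \<Longrightarrow> H x \<le> H y" "continuous_on UNIV H" for l u and H :: "real \<Rightarrow> real"
  proof -
    have "emeasure (interval_measure H) ({l..u} - {l} - {u}) = H u - H l"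
    proof -
      have s: "emeasure (interval_measure H) {z} = 0" for z
        using emeasure_interval_measure_Icc[of z z H] H by auto
      have "emeasure (interval_measure H) ({l..u} - {l} - {u}) = emeasure (interval_measure H) {l..u}"
        using s by (subst emeasure_Diff_null_set, auto simp: null_sets_def)+
      then show ?thesis
        using emeasure_interval_measure_Icc[of l u H] that by auto
    qed
    moreover have "{l..u} - {l} - {u} = {l<..<u}" by auto
    ultimately show ?thesis by simp
  qed
  have "lborel = S"
  proof (rule lborel_eqI)
    fix l u :: real assume "\<And>b. b \<in> Basis \<Longrightarrow> l \<bullet> b \<le> u \<bullet> b"
    then have lu: "l \<le> u" by simp
    have "emeasure S (box l u) = ennreal (1 / c) * (ennreal (F u - F l) + ennreal (G u - G l))"
      using lu by (subst em_S) (auto simp: Ioo F G box_real)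
    also have "\<dots> = ennreal ((1 / c) * (F u - F l + (G u - G l)))"
      using c F(1)[OF lu] G(1)[OF lu]
      by (simp only: ennreal_plus[symmetric] ennreal_mult'[symmetric] diff_ge_0_iff_ge
          zero_le_divide_1_iff less_imp_le)
    also have "F u - F l + (G u - G l) = c * (u - l)"
      using sum[of u] sum[of l] by (simp add: algebra_simps)
    finally show "emeasure S (box l u) = ennreal (\<Prod>b\<in>Basis. (u - l) \<bullet> b)"
      using c by simp
  qed (rule sets_S)
  then have "ennreal c * emeasure lborel A = ennreal c * ?S A"
    using em_S[OF A] by simp
  also have "\<dots> = (ennreal c * ennreal (1 / c)) * (emeasure (interval_measure F) A + emeasure (interval_measure G) A)"
    by (simp add: mult.assoc)
  also have "ennreal c * ennreal (1 / c) = 1"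
    using c by (simp add: ennreal_mult'[symmetric])
  finally show ?thesis by simp
qed

section \<open>Steep points and differentiability almost everywhere on the line\<close>

text \<open>The point may lie anywhere in the interval, endpoints included; this makes the set open
  and supplies covering intervals directly. Applied to \<open>- f\<close> with \<open>- p\<close>,
  it records slopes of \<open>f\<close> below \<open>p\<close>.\<close>

definition steep :: "(real \<Rightarrow> real) \<Rightarrow> real \<Rightarrow> real \<Rightarrow> real set" where
  "steep f q d = {x. \<exists>a b. a \<le> x \<and> x \<le> b \<and> a < b \<and> b - a < d \<and> q * (b - a) < f b - f a}"

lemma not_steepD:
  "\<lbrakk>x \<notin> steep f q d; a \<le> x; x \<le> b; a < b; b - a < d\<rbrakk> \<Longrightarrow> f b - f a \<le> q * (b - a)"
  unfolding steep_def by force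

lemma steep_mono:
  assumes "q \<le> q'" "d' \<le> d"
  shows "steep f q' d' \<subseteq> steep f q d"
proof
  fix x assume "x \<in> steep f q' d'"
  then obtain a b where ab: "a \<le> x" "x \<le> b" "a < b" "b - a < d'" "q' * (b - a) < f b - f a"
    by (auto simp: steep_def)
  then have "q * (b - a) \<le> q' * (b - a)" using assms by (intro mult_right_mono) auto
  with ab assms show "x \<in> steep f q d"
    unfolding steep_def by (intro CollectI exI[of _ a] exI[of _ b] conjI) linarith+
qed

text \<open>Widening the interval slightly on both sides keeps the strict inequalities, by
  continuity, and makes it a witness for all points near \<open>x\<close>, even when
  \<open>x\<close> was an endpoint.\<close>

lemma open_steep:
  assumes "continuous_on UNIV f"
  shows "open (steep f q d)"
  unfolding open_dist
proof
  fix x assume "x \<in> steep f q d"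
  then obtain a b where ab: "a \<le> x" "x \<le> b" "a < b" "b - a < d" "q * (b - a) < f b - f a"
    by (auto simp: steep_def)
  have f: "isCont f z" for z
    using assms by (simp add: continuous_on_eq_continuous_at)
  have "((\<lambda>s. (b + s) - (a - s)) \<longlongrightarrow> (b + 0) - (a - 0)) (at_right 0)"
    by (intro tendsto_intros)
  then have 1: "\<forall>\<^sub>F s in at_right 0. (b + s) - (a - s) < d"
    using ab(4) by (auto dest: order_tendstoD(2))
  have "((\<lambda>s. f (b + s)) \<longlongrightarrow> f b) (at_right 0)" "((\<lambda>s. f (a - s)) \<longlongrightarrow> f a) (at_right 0)"
    by (rule isCont_tendsto_compose[OF f], rule tendsto_eq_intros, rule tendsto_const,
        rule tendsto_ident_at, simp)+
  then have "((\<lambda>s. (f (b + s) - f (a - s)) - q * ((b + s) - (a - s))) \<longlongrightarrow> f b - f a - q * ((b + 0) - (a - 0))) (at_right 0)"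
    by (rule tendsto_diff[OF tendsto_diff]) (intro tendsto_intros)
  then have 2: "\<forall>\<^sub>F s in at_right 0. 0 < f (b + s) - f (a - s) - q * ((b + s) - (a - s))"
    using ab(5) by (intro order_tendstoD(1)) auto
  have "\<forall>\<^sub>F s in at_right 0. (b + s) - (a - s) < d \<and> 0 < f (b + s) - f (a - s) - q * ((b + s) - (a - s)) \<and> 0 < s"
    by (intro eventually_conj 1 2 eventually_at_right_less)
  then obtain s where s: "(b + s) - (a - s) < d" "0 < f (b + s) - f (a - s) - q * ((b + s) - (a - s))" "0 < s"
    by (auto dest: eventually_happens)
  have "y \<in> steep f q d" if "dist y x < s" for y
  proof -
    have "a - s \<le> y \<and> y \<le> b + s" using that ab by (auto simp: dist_real_def abs_less_iff)
    moreover have "a - s < b + s" using ab s by linarith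
    ultimately show ?thesis
      unfolding steep_def using s by (intro CollectI exI[of _ "a - s"] exI[of _ "b + s"]) linarith
  qed
  then show "\<exists>e>0. \<forall>y. dist y x < e \<longrightarrow> y \<in> steep f q d"
    using s(3) by blast
qed

text \<open>\<open>Inf S\<close> is the upper limit of the slopes over shrinking intervals that
  contain \<open>x\<close>. A rational \<open>q\<close> below it is exceeded at every scale, so
  \<open>pq\<close> excludes slopes below any rational \<open>p < q\<close> at small scales; hence
  the lower limit is the same number.\<close>

lemma differentiable_if_not_steep:
  fixes f :: "real \<Rightarrow> real"
  assumes lip: "L-lipschitz_on UNIV f"
    and pq: "\<And>p q. \<lbrakk>p \<in> \<rat>; q \<in> \<rat>; p < q\<rbrakk> \<Longrightarrow>
      \<exists>d>0. x \<notin> steep f q d \<or> x \<notin> steep (\<lambda>y. - f y) (- p) d"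
  shows "f differentiable at x"
proof -
  have bound: "\<bar>f b - f a\<bar> \<le> L * (b - a)" if "a < b" for a b
    using lipschitz_onD[OF lip, of b a] that by (simp add: dist_real_def)
  define S where "S = {q. \<exists>d>0. x \<notin> steep f q d}"
  have "L \<in> S"
  proof -
    have "x \<notin> steep f L 1"
      unfolding steep_def using bound by (smt (verit) mem_Collect_eq)
    then show ?thesis unfolding S_def using zero_less_one by blast
  qed
  have low: "-L \<le> q" if "q \<in> S" for q
  proof -
    from that obtain d where "d > 0" "x \<notin> steep f q d" by (auto simp: S_def)
    then have "f (x + d / 2) - f x \<le> q * (d / 2)"
      using not_steepD[of x f q d x "x + d / 2"] by simp
    moreover have "- (L * (d / 2)) \<le> f (x + d / 2) - f x"
      using bound[of x "x + d / 2"] \<open>d > 0\<close> unfolding abs_le_iff by simp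
    ultimately have "(-L) * (d / 2) \<le> q * (d / 2)" by simp
    then show ?thesis using \<open>d > 0\<close> by (simp only: mult_le_cancel_right)
  qed
  have up: "q' \<in> S" if "q \<in> S" "q \<le> q'" for q q'
  proof -
    from that obtain d where "d > 0" "x \<notin> steep f q d" by (auto simp: S_def)
    moreover have "steep f q' d \<subseteq> steep f q d"
      using that(2) by (intro steep_mono) auto
    ultimately show ?thesis by (auto simp: S_def)
  qed
  define A where "A = Inf S"
  have bdd: "bdd_below S" using low by (auto simp: bdd_below_def)
  have hi: "\<exists>d>0. \<forall>a b. a \<le> x \<and> x \<le> b \<and> a < b \<and> b - a < d \<longrightarrow> f b - f a \<le> (A + e) * (b - a)"
    if "e > 0" for e
  proof -
    have "Inf S < A + e" using that by (simp add: A_def)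
    then obtain q where "q \<in> S" "q < A + e"
      using cInf_less_iff[of S "A + e"] bdd \<open>L \<in> S\<close> by auto
    then have "A + e \<in> S" by (meson up less_imp_le)
    then show ?thesis using not_steepD[of x f "A + e"] unfolding S_def mem_Collect_eq by meson
  qed
  have lo: "\<exists>d>0. \<forall>a b. a \<le> x \<and> x \<le> b \<and> a < b \<and> b - a < d \<longrightarrow> (A - e) * (b - a) \<le> f b - f a"
    if e: "e > 0" for e
  proof -
    obtain p where p: "p \<in> \<rat>" "A - e < p" "p < A"
      using Rats_dense_in_real[of "A - e" A] e by auto
    obtain q where q: "q \<in> \<rat>" "p < q" "q < A"
      using Rats_dense_in_real[of p A] p by auto
    have "q \<notin> S" using q(3) cInf_lower[OF _ bdd, of q] by (auto simp: A_def)
    then obtain d where d: "d > 0" "x \<notin> steep (\<lambda>y. - f y) (- p) d"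
      using pq[OF p(1) q(1,2)] by (auto simp: S_def)
    have "(A - e) * (b - a) \<le> f b - f a" if "a \<le> x" "x \<le> b" "a < b" "b - a < d" for a b
    proof -
      have "p * (b - a) \<le> f b - f a"
        using not_steepD[OF d(2) that] by simp
      moreover have "(A - e) * (b - a) \<le> p * (b - a)"
        using p(2) that by (intro mult_right_mono) auto
      ultimately show ?thesis by linarith
    qed
    then show ?thesis using d(1) by blast
  qed
  have "(f has_derivative (\<lambda>h. A * h)) (at x)"
    unfolding has_derivative_at_alt
  proof (intro conjI allI impI)
    show "bounded_linear ((*) A)" by (rule bounded_linear_mult_right)
    fix e :: real assume "e > 0"
    obtain d1 where d1: "d1 > 0" "\<And>a b. \<lbrakk>a \<le> x; x \<le> b; a < b; b - a < d1\<rbrakk> \<Longrightarrow> f b - f a \<le> (A + e) * (b - a)"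
      using hi[OF \<open>e > 0\<close>] by blast
    obtain d2 where d2: "d2 > 0" "\<And>a b. \<lbrakk>a \<le> x; x \<le> b; a < b; b - a < d2\<rbrakk> \<Longrightarrow> (A - e) * (b - a) \<le> f b - f a"
      using lo[OF \<open>e > 0\<close>] by blast
    have "norm (f y - f x - A * (y - x)) \<le> e * norm (y - x)" if "norm (y - x) < min d1 d2" for y
    proof (cases y x rule: linorder_cases)
      case less
      then show ?thesis
        using d1(2)[of y x] d2(2)[of y x] that by (auto simp: algebra_simps abs_le_iff)
    next
      case greater
      then show ?thesis
        using d1(2)[of x y] d2(2)[of x y] that by (auto simp: algebra_simps abs_le_iff)
    qed auto
    then show "\<exists>d>0. \<forall>y. norm (y - x) < d \<longrightarrow> norm (f y - f x - A * (y - x)) \<le> e * norm (y - x)"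
      using d1(1) d2(1) by (intro exI[of _ "min d1 d2"]) auto
  qed
  then show ?thesis by (rule differentiableI)
qed

text \<open>On a steep interval the increment of \<open>F\<close> exceeds \<open>L + q\<close> times
  the length, and for continuous \<open>F\<close> this increment is the Stieltjes measure of the
  closed interval. Closed intervals are closed balls, so they form a fine cover of
  \<open>E\<close>.\<close>

lemma steep_measure_lower_bound:
  fixes f F :: "real \<Rightarrow> real"
  assumes F: "\<And>x y. x \<le> y \<Longrightarrow> F x \<le> F y" "continuous_on UNIV F"
    and upper: "\<And>A. A \<in> sets borel \<Longrightarrow> emeasure (interval_measure F) A \<le> ennreal C * emeasure lborel A"
    and Ff: "\<And>x. F x = L * x + f x"
    and E: "E \<in> sets borel" "\<And>d. d > 0 \<Longrightarrow> E \<subseteq> steep f q d"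
  shows "ennreal (L + q) * emeasure lborel E \<le> emeasure (interval_measure F) E"
proof (rule Vitali_measure_lower_bound[OF _ upper E(1)])
  fix x d :: real assume "x \<in> E" "0 < d"
  then obtain a b where ab: "a \<le> x" "x \<le> b" "a < b" "b - a < d" "q * (b - a) < f b - f a"
    using E(2)[OF \<open>0 < d\<close>] by (auto simp: steep_def)
  define c r where "c = (a + b) / 2" and "r = (b - a) / 2"
  have cball: "cball c r = {a..b}"
    by (simp add: c_def r_def cball_eq_atLeastAtMost) (simp add: field_simps)
  have "ennreal (L + q) * emeasure lborel {a..b} = ennreal ((L + q) * (b - a))"
    using ab by (simp add: ennreal_mult'')
  also have "\<dots> \<le> ennreal (F b - F a)"
    using ab by (intro ennreal_leI) (auto simp: Ff algebra_simps)
  also have "\<dots> = emeasure (interval_measure F) {a..b}"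
    using ab F by (subst emeasure_interval_measure_Icc) auto
  finally show "\<exists>c r. x \<in> cball c r \<and> 0 < r \<and> r < d \<and>
      ennreal (L + q) * emeasure lborel (cball c r) \<le> emeasure (interval_measure F) (cball c r)"
    using ab cball by (intro exI[of _ c] exI[of _ r]) (auto simp: r_def simp del: mem_cball)
qed simp

text \<open>The Stieltjes measures of \<open>K x + f x\<close> and \<open>K x - f x\<close> sum to \<open>2 K\<close> times Lebesgue measure. On a set
  \<open>E\<close> where slopes above \<open>q\<close> and below \<open>p < q\<close> occur at all scales they are at least \<open>K + q\<close> and
  \<open>K - p\<close> times Lebesgue measure, which forces \<open>E\<close> to be null.\<close>

theorem lipschitz_AE_differentiable_real:
  fixes f :: "real \<Rightarrow> real"
  assumes "L-lipschitz_on UNIV f"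
  shows "AE x in lborel. f differentiable at x"
proof -
  \<comment> \<open>One more than \<open>L\<close>, so that the factor \<open>2 * K\<close> is
    positive even when \<open>L\<close> is 0.\<close>
  define K where "K = L + 1"
  have "0 \<le> L" using assms lipschitz_on_nonneg by blast
  then have "K > 0" by (simp add: K_def)
  have lip: "\<bar>f b - f a\<bar> \<le> K * (b - a)" if "a \<le> b" for a b
    using lipschitz_onD[OF assms, of b a] that by (auto simp: dist_real_def K_def algebra_simps)
  have f: "continuous_on UNIV f" using assms by (rule lipschitz_on_continuous_on)
  define F G where "F = (\<lambda>x. K * x + f x)" and "G = (\<lambda>x. K * x + - f x)"
  have F: "F x \<le> F y" if "x \<le> y" for x y
    using lip[OF that] by (auto simp: F_def algebra_simps)
  have G: "G x \<le> G y" if "x \<le> y" for x y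
    using lip[OF that] by (auto simp: G_def algebra_simps)
  have cF: "continuous_on UNIV F" and cG: "continuous_on UNIV G"
    unfolding F_def G_def using f by (auto intro!: continuous_intros)
  have sum: "emeasure (interval_measure F) A + emeasure (interval_measure G) A
      = ennreal (2 * K) * emeasure lborel A" if "A \<in> sets borel" for A
    by (rule interval_measure_add_eq_lborel[OF F cF G cG _ _ that]) (use \<open>K > 0\<close> in \<open>auto simp: F_def G_def\<close>)
  have upF: "emeasure (interval_measure F) A \<le> ennreal (2 * K) * emeasure lborel A" if "A \<in> sets borel" for A
    by (subst sum[OF that, symmetric]) (rule add_increasing2, auto)
  have upG: "emeasure (interval_measure G) A \<le> ennreal (2 * K) * emeasure lborel A" if "A \<in> sets borel" for A
    by (subst sum[OF that, symmetric]) (rule add_increasing, auto)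
  \<comment> \<open>Countably many scales keep the set Borel; the cut to a bounded interval makes
    its measure finite, which permits the passage to real numbers below.\<close>
  define E where "E p q k = (\<Inter>n. steep f q (1 / real (Suc n)) \<inter> steep (\<lambda>y. - f y) (- p) (1 / real (Suc n)))
    \<inter> {- real k..real k}" for p q :: real and k :: nat
  have null: "E p q k \<in> null_sets lborel" if "p < q" for p q k
  proof -
    have meas: "E p q k \<in> sets borel"
    proof -
      have "steep f q d \<in> sets borel" "steep (\<lambda>y. - f y) (- p) d \<in> sets borel" for d
        using f by (auto intro!: borel_open open_steep continuous_on_minus)
      then show ?thesis
        unfolding E_def by (intro sets.Int sets.countable_INT'') auto
    qed
    have sub: "E p q k \<subseteq> steep f q d" "E p q k \<subseteq> steep (\<lambda>y. - f y) (- p) d" if d: "d > 0" for d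
    proof -
      obtain n where n: "1 / real (Suc n) < d"
        using nat_approx_posE[OF d] by auto
      have "E p q k \<subseteq> steep f q (1 / real (Suc n))" "E p q k \<subseteq> steep (\<lambda>y. - f y) (- p) (1 / real (Suc n))"
        by (auto simp: E_def)
      moreover have "steep g r (1 / real (Suc n)) \<subseteq> steep g r d" for g r
        using n by (intro steep_mono) auto
      ultimately show "E p q k \<subseteq> steep f q d" "E p q k \<subseteq> steep (\<lambda>y. - f y) (- p) d"
        by (meson order_trans)+
    qed
    let ?m = "emeasure lborel (E p q k)"
    have "?m \<le> emeasure lborel {- real k..real k}"
      by (intro emeasure_mono) (auto simp: E_def)
    then have fin: "?m < \<infinity>" by (auto intro: le_less_trans)
    have "ennreal (K + q) * ?m \<le> emeasure (interval_measure F) (E p q k)"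
      by (rule steep_measure_lower_bound[OF F cF upF _ meas sub(1)]) (auto simp: F_def)
    moreover have "ennreal (K + - p) * ?m \<le> emeasure (interval_measure G) (E p q k)"
      by (rule steep_measure_lower_bound[OF G cG upG _ meas sub(2)]) (auto simp: G_def)
    ultimately have "ennreal (K + q) * ?m + ennreal (K - p) * ?m \<le> ennreal (2 * K) * ?m"
      by (subst sum[OF meas, symmetric]) (auto intro: add_mono)
    moreover obtain m where m: "?m = ennreal m" "m \<ge> 0"
      using fin by (cases ?m) auto
    ultimately have "ennreal ((K + q) * m) + ennreal ((K - p) * m) \<le> ennreal (2 * K * m)"
      by (simp add: ennreal_mult'')
    \<comment> \<open>Truncation at 0 by \<open>ennreal\<close> can only raise the left side, so the
      real inequality follows whatever the signs of \<open>K + q\<close> and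
      \<open>K - p\<close>.\<close>
    then have "(K + q) * m + (K - p) * m \<le> 2 * K * m"
      using \<open>K > 0\<close> m(2)
      by (smt (verit) ennreal_le_iff ennreal_plus_if mult_nonneg_nonneg)
    then have "(q - p) * m \<le> 0" by (simp add: algebra_simps)
    then have "m = 0" using that m(2) by (simp add: mult_le_0_iff)
    then show ?thesis using m meas by (auto simp: null_sets_def)
  qed
  have cnt: "countable {(p, q). p \<in> \<rat> \<and> q \<in> \<rat> \<and> p < (q::real)}"
    by (rule countable_subset[of _ "\<rat> \<times> \<rat>"]) (auto intro: countable_rat)
  have "AE x in lborel. \<forall>(p, q) \<in> {(p, q). p \<in> \<rat> \<and> q \<in> \<rat> \<and> p < q}. \<forall>k. x \<notin> E p q k"
    unfolding AE_ball_countable[OF cnt]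
    by (intro ballI, clarify, subst AE_all_countable) (intro allI AE_not_in null)
  then show ?thesis
  proof (rule AE_mp, intro AE_I2 impI)
    fix x :: real
    assume x: "\<forall>(p, q) \<in> {(p, q). p \<in> \<rat> \<and> q \<in> \<rat> \<and> p < q}. \<forall>k. x \<notin> E p q k"
    show "f differentiable at x"
    proof (rule differentiable_if_not_steep[OF assms])
      fix p q :: real assume pq: "p \<in> \<rat>" "q \<in> \<rat>" "p < q"
      obtain k where "\<bar>x\<bar> \<le> real k" using real_arch_simple by blast
      moreover have "x \<notin> E p q k" using x pq by auto
      ultimately have "\<exists>n. x \<notin> steep f q (1 / real (Suc n)) \<or> x \<notin> steep (\<lambda>y. - f y) (- p) (1 / real (Suc n))"
        unfolding E_def abs_le_iff Int_iff INT_iff atLeastAtMost_iff by force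
      then show "\<exists>d>0. x \<notin> steep f q d \<or> x \<notin> steep (\<lambda>y. - f y) (- p) d"
        by (meson of_nat_0_less_iff zero_less_Suc zero_less_divide_1_iff)
    qed
  qed
qed

section \<open>Directional derivatives\<close>

text \<open>Restricting to the steps \<open>1 / Suc n\<close> makes the derivative a sequential
  limit, open to measurability of limits and to dominated convergence.\<close>

definition dquot :: "('a::real_normed_vector \<Rightarrow> real) \<Rightarrow> 'a \<Rightarrow> nat \<Rightarrow> 'a \<Rightarrow> real" where
  "dquot u v n x = (u (x + (1 / real (Suc n)) *\<^sub>R v) - u x) * real (Suc n)"

text \<open>The value is arbitrary where the quotients diverge.\<close>

definition dir_deriv :: "('a::real_normed_vector \<Rightarrow> real) \<Rightarrow> 'a \<Rightarrow> 'a \<Rightarrow> real" where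
  "dir_deriv u v x = lim (\<lambda>n. dquot u v n x)"

lemma dquot_tendsto:
  assumes "((\<lambda>t. u (x + t *\<^sub>R v)) has_real_derivative D) (at 0)"
  shows "(\<lambda>n. dquot u v n x) \<longlonglongrightarrow> D"
proof -
  have "((\<lambda>t. (u (x + t *\<^sub>R v) - u x) / t) \<longlongrightarrow> D) (at 0)"
    using assms by (simp add: has_field_derivative_iff)
  moreover have "filterlim (\<lambda>n. 1 / real (Suc n)) (at 0) sequentially"
    using lim_1_over_n[THEN LIMSEQ_Suc] by (auto simp: filterlim_at)
  ultimately have "(\<lambda>n. (u (x + (1 / real (Suc n)) *\<^sub>R v) - u x) / (1 / real (Suc n))) \<longlonglongrightarrow> D"
    by (rule filterlim_compose)
  then show ?thesis by (simp add: dquot_def)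
qed

lemma dir_deriv_eq:
  "((\<lambda>t. u (x + t *\<^sub>R v)) has_real_derivative D) (at 0) \<Longrightarrow> dir_deriv u v x = D"
  unfolding dir_deriv_def by (intro limI dquot_tendsto)

lemma abs_dquot_le:
  assumes "L-lipschitz_on UNIV u"
  shows "\<bar>dquot u v n x\<bar> \<le> L * norm v"
proof -
  have "\<bar>u (x + (1 / real (Suc n)) *\<^sub>R v) - u x\<bar> \<le> L * norm ((1 / real (Suc n)) *\<^sub>R v)"
    using lipschitz_onD[OF assms, of "x + (1 / real (Suc n)) *\<^sub>R v" x] by (simp add: dist_norm)
  then have "\<bar>u (x + (1 / real (Suc n)) *\<^sub>R v) - u x\<bar> * real (Suc n) \<le> L * norm ((1 / real (Suc n)) *\<^sub>R v) * real (Suc n)"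
    by (intro mult_right_mono) auto
  then show ?thesis by (simp add: dquot_def abs_mult)
qed

lemma dquot_measurable:
  fixes u :: "'a::euclidean_space \<Rightarrow> real"
  assumes "continuous_on UNIV u"
  shows "dquot u v n \<in> borel_measurable borel"
  unfolding dquot_def[abs_def]
  by (intro borel_measurable_continuous_onI continuous_intros continuous_on_compose2[OF assms]) auto

lemma dir_deriv_measurable:
  fixes u :: "'a::euclidean_space \<Rightarrow> real"
  assumes "continuous_on UNIV u"
  shows "dir_deriv u v \<in> borel_measurable borel"
  unfolding dir_deriv_def[abs_def]
  by (intro borel_measurable_lim_metric dquot_measurable assms)

text \<open>Unlike the definition, this form does not mention the derivative: countable operations
  lead to it from inequalities that are closed in any parameter on which \<open>g\<close> depends continuously.\<close>

lemma differentiable_at_0_iff_Cauchy: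
  fixes g :: "real \<Rightarrow> real"
  shows "g differentiable (at 0) \<longleftrightarrow>
    (\<forall>m::nat. \<exists>k::nat. \<forall>s t. 0 < \<bar>s\<bar> \<and> \<bar>s\<bar> < 1 / real (Suc k) \<and> 0 < \<bar>t\<bar> \<and> \<bar>t\<bar> < 1 / real (Suc k) \<longrightarrow>
      \<bar>(g s - g 0) / s - (g t - g 0) / t\<bar> \<le> 1 / real (Suc m))"
    (is "_ \<longleftrightarrow> (\<forall>m. \<exists>k. ?C m k)")
proof
  assume "g differentiable (at 0)"
  then obtain D where "((\<lambda>t. (g t - g 0) / t) \<longlongrightarrow> D) (at 0)"
    unfolding real_differentiable_def has_field_derivative_iff by auto
  then have lim: "\<exists>d>0. \<forall>t. t \<noteq> 0 \<and> \<bar>t\<bar> < d \<longrightarrow> \<bar>(g t - g 0) / t - D\<bar> < e" if "e > 0" for e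
    using that unfolding LIM_eq real_norm_def diff_0_right by blast
  have le: "\<bar>a - b\<bar> \<le> e" if "\<bar>a - D\<bar> < e / 2" "\<bar>b - D\<bar> < e / 2" for a b D e :: real
    using that by linarith
  show "\<forall>m. \<exists>k. ?C m k"
  proof
    fix m
    obtain d where d: "d > 0" "\<And>t. \<lbrakk>t \<noteq> 0; \<bar>t\<bar> < d\<rbrakk> \<Longrightarrow> \<bar>(g t - g 0) / t - D\<bar> < 1 / real (Suc m) / 2"
      using lim[of "1 / real (Suc m) / 2"] half_gt_zero[of "1 / real (Suc m)"]
      by (metis of_nat_0_less_iff zero_less_Suc zero_less_divide_1_iff)
    obtain k where k: "1 / real (Suc k) < d"
      using nat_approx_posE[OF d(1)] by auto
    have "?C m k"
    proof (intro allI impI)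
      fix s t :: real
      assume st: "0 < \<bar>s\<bar> \<and> \<bar>s\<bar> < 1 / real (Suc k) \<and> 0 < \<bar>t\<bar> \<and> \<bar>t\<bar> < 1 / real (Suc k)"
      then have "\<bar>(g s - g 0) / s - D\<bar> < 1 / real (Suc m) / 2" "\<bar>(g t - g 0) / t - D\<bar> < 1 / real (Suc m) / 2"
        using k by (intro d(2); linarith)+
      then show "\<bar>(g s - g 0) / s - (g t - g 0) / t\<bar> \<le> 1 / real (Suc m)"
        using le[of "(g s - g 0) / s" D "1 / real (Suc m)" "(g t - g 0) / t"] by simp
    qed
    then show "\<exists>k. ?C m k" by blast
  qed
next
  assume C: "\<forall>m. \<exists>k. ?C m k"
  define q where "q t = (g t - g 0) / t" for t
  have C': "\<exists>k. \<forall>s t. 0 < \<bar>s\<bar> \<and> \<bar>s\<bar> < 1 / real (Suc k) \<and> 0 < \<bar>t\<bar> \<and> \<bar>t\<bar> < 1 / real (Suc k) \<longrightarrow> \<bar>q s - q t\<bar> < e"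
    if e: "e > 0" for e
  proof -
    obtain m where m: "1 / real (Suc m) < e" using nat_approx_posE[OF e] by auto
    obtain k where k: "?C m k" using C by blast
    show ?thesis
    proof (intro exI[of _ k] allI impI)
      fix s t :: real
      assume "0 < \<bar>s\<bar> \<and> \<bar>s\<bar> < 1 / real (Suc k) \<and> 0 < \<bar>t\<bar> \<and> \<bar>t\<bar> < 1 / real (Suc k)"
      with k have "\<bar>q s - q t\<bar> \<le> 1 / real (Suc m)" unfolding q_def by blast
      with m show "\<bar>q s - q t\<bar> < e" by (rule le_less_trans[rotated])
    qed
  qed
  \<comment> \<open>The second \<open>Suc\<close> makes the inequality strict already at
    \<open>n = k\<close>, as the condition on the steps demands.\<close>
  have inv: "1 / real (Suc (Suc n)) < 1 / real (Suc k)" if "n \<ge> k" for n k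
    using that by (intro divide_strict_left_mono) auto
  have pos: "0 < 1 / real (Suc n)" for n by simp
  have "Cauchy (\<lambda>n. q (1 / real (Suc (Suc n))))"
  proof (rule CauchyI)
    fix e :: real assume "e > 0"
    then obtain k where k: "\<And>s t. 0 < \<bar>s\<bar> \<and> \<bar>s\<bar> < 1 / real (Suc k) \<and> 0 < \<bar>t\<bar> \<and> \<bar>t\<bar> < 1 / real (Suc k) \<Longrightarrow> \<bar>q s - q t\<bar> < e"
      using C' by blast
    show "\<exists>M. \<forall>m\<ge>M. \<forall>n\<ge>M. norm (q (1 / real (Suc (Suc m))) - q (1 / real (Suc (Suc n)))) < e"
    proof (intro exI[of _ k] allI impI)
      fix m n assume "k \<le> m" "k \<le> n"
      then show "norm (q (1 / real (Suc (Suc m))) - q (1 / real (Suc (Suc n)))) < e"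
        unfolding real_norm_def by (intro k conjI) (simp_all only: abs_of_pos pos inv)
    qed
  qed
  then obtain D where D: "(\<lambda>n. q (1 / real (Suc (Suc n)))) \<longlonglongrightarrow> D"
    using Cauchy_convergent convergent_def by blast
  have "(q \<longlongrightarrow> D) (at 0)"
    unfolding LIM_eq
  proof (intro allI impI)
    fix e :: real assume e: "e > 0"
    then obtain k where k: "\<And>s t. 0 < \<bar>s\<bar> \<and> \<bar>s\<bar> < 1 / real (Suc k) \<and> 0 < \<bar>t\<bar> \<and> \<bar>t\<bar> < 1 / real (Suc k) \<Longrightarrow> \<bar>q s - q t\<bar> < e / 2"
      using C'[OF half_gt_zero[OF e]] by blast
    have "\<bar>q t - D\<bar> \<le> e / 2" if t: "t \<noteq> 0" "\<bar>t\<bar> < 1 / real (Suc k)" for t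
    proof (rule LIMSEQ_le_const2)
      show "(\<lambda>n. \<bar>q t - q (1 / real (Suc (Suc n)))\<bar>) \<longlonglongrightarrow> \<bar>q t - D\<bar>"
        by (intro tendsto_intros D)
      have "\<bar>q t - q (1 / real (Suc (Suc n)))\<bar> \<le> e / 2" if "k \<le> n" for n
      proof (rule less_imp_le, rule k)
        show "0 < \<bar>t\<bar> \<and> \<bar>t\<bar> < 1 / real (Suc k) \<and> 0 < \<bar>1 / real (Suc (Suc n))\<bar> \<and> \<bar>1 / real (Suc (Suc n))\<bar> < 1 / real (Suc k)"
          using inv[OF that] t by (simp only: abs_of_pos pos) simp
      qed
      then show "\<exists>N. \<forall>n\<ge>N. \<bar>q t - q (1 / real (Suc (Suc n)))\<bar> \<le> e / 2"
        by blast
    qed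
    then have "norm (q t - D) < e" if "t \<noteq> 0" "norm (t - 0) < 1 / real (Suc k)" for t
      unfolding real_norm_def
      by (rule le_less_trans) (use e that in simp_all)
    then show "\<exists>s>0. \<forall>x. x \<noteq> 0 \<and> norm (x - 0) < s \<longrightarrow> norm (q x - D) < e"
      by (intro exI[of _ "1 / real (Suc k)"]) (simp del: of_nat_Suc)
  qed
  then have "(g has_real_derivative D) (at 0)"
    by (simp add: has_field_derivative_iff q_def[abs_def])
  then show "g differentiable (at 0)"
    by (auto simp: real_differentiable_def)
qed

section \<open>Directional differentiability almost everywhere, by Fubini\<close>

text \<open>For fixed steps the Cauchy inequality is a closed condition on \<open>x\<close>, and
  closedness survives the uncountable intersection over all pairs of steps. Only \<open>m\<close>
  and \<open>k\<close> range over countable sets.\<close>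

lemma directional_differentiable_measurable:
  fixes u :: "'a::euclidean_space \<Rightarrow> real"
  assumes u: "continuous_on UNIV u"
  shows "{x. (\<lambda>t. u (x + t *\<^sub>R v)) differentiable (at 0)} \<in> sets borel"
proof -
  define Q where "Q m k s t = {x. \<bar>(u (x + s *\<^sub>R v) - u x) / s - (u (x + t *\<^sub>R v) - u x) / t\<bar> \<le> 1 / real (Suc m)}"
    for m k :: nat and s t :: real
  define T where "T k = {(s, t). 0 < \<bar>s\<bar> \<and> \<bar>s\<bar> < 1 / real (Suc k) \<and> 0 < \<bar>t\<bar> \<and> \<bar>t\<bar> < 1 / real (Suc k)}" for k
  have "closed (Q m k s t)" for m k s t
    unfolding Q_def divide_inverse
    by (intro closed_Collect_le continuous_intros continuous_on_compose2[OF u]) auto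
  then have "closed (\<Inter>(s, t)\<in>T k. Q m k s t)" for m k
    by (intro closed_INT) auto
  moreover have "{x. (\<lambda>t. u (x + t *\<^sub>R v)) differentiable (at 0)} = (\<Inter>m. \<Union>k. \<Inter>(s, t)\<in>T k. Q m k s t)"
    unfolding differentiable_at_0_iff_Cauchy by (auto simp: Q_def T_def)
  ultimately show ?thesis
    by (auto intro!: sets.countable_INT'' sets.countable_UN borel_closed)
qed

lemma AE_lborel_translate:
  fixes c :: "'a::euclidean_space"
  assumes "{x. P x} \<in> sets borel" "AE x in lborel. P (c + x)"
  shows "AE x in lborel. P x"
proof -
  have "AE x in distr lborel borel ((+) c). P x"
    using assms by (subst AE_distr_iff) auto
  then show ?thesis by (simp only: lborel_distr_plus)
qed

text \<open>For every \<open>x\<close> the one-dimensional theorem gives differentiability at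
  \<open>x + t *\<^sub>R v\<close> for almost every \<open>t\<close>. Fubini exchanges the
  quantifiers, so a single \<open>t\<close> works for almost every \<open>x\<close>, and translating
  back by it preserves null sets.\<close>

lemma lipschitz_AE_directional_differentiable:
  fixes u :: "'a::euclidean_space \<Rightarrow> real"
  assumes lip: "L-lipschitz_on UNIV u"
  shows "AE x in lborel. (\<lambda>t. u (x + t *\<^sub>R v)) differentiable (at 0)"
proof -
  define P where "P x \<longleftrightarrow> (\<lambda>t. u (x + t *\<^sub>R v)) differentiable (at 0)" for x
  have u: "continuous_on UNIV u" using lip by (rule lipschitz_on_continuous_on)
  have P: "{x. P x} \<in> sets borel"
    unfolding P_def by (rule directional_differentiable_measurable[OF u])
  have "0 \<le> L" using lip lipschitz_on_nonneg by blast
  have "AE t in lborel. P (x + t *\<^sub>R v)" for x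
  proof -
    have "(L * norm v)-lipschitz_on UNIV (\<lambda>t. u (x + t *\<^sub>R v))"
    proof (rule lipschitz_onI)
      fix s t :: real
      have "dist (u (x + s *\<^sub>R v)) (u (x + t *\<^sub>R v)) \<le> L * dist (x + s *\<^sub>R v) (x + t *\<^sub>R v)"
        using lip by (rule lipschitz_onD) auto
      also have "dist (x + s *\<^sub>R v) (x + t *\<^sub>R v) = norm v * dist s t"
        by (simp add: dist_norm scaleR_diff_left[symmetric])
      finally show "dist (u (x + s *\<^sub>R v)) (u (x + t *\<^sub>R v)) \<le> L * norm v * dist s t"
        by (simp add: mult.assoc)
    qed (use \<open>0 \<le> L\<close> in auto)
    then have "AE t in lborel. (\<lambda>t. u (x + t *\<^sub>R v)) differentiable (at t)"
      by (rule lipschitz_AE_differentiable_real)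
    then show ?thesis
    proof (rule AE_mp, intro AE_I2 impI)
      fix t assume d: "(\<lambda>t. u (x + t *\<^sub>R v)) differentiable (at t)"
      have "(\<lambda>t. u (x + t *\<^sub>R v)) \<circ> (\<lambda>s. t + s) differentiable (at 0)"
        using d by (intro differentiable_chain_at) auto
      then show "P (x + t *\<^sub>R v)"
        by (simp add: P_def o_def scaleR_add_left add.assoc)
    qed
  qed
  then have "AE x in lborel. AE t in lborel. P (x + t *\<^sub>R v)" by simp
  moreover have "{z \<in> space (lborel \<Otimes>\<^sub>M lborel). P (fst z + snd z *\<^sub>R v)} \<in> sets (lborel \<Otimes>\<^sub>M (lborel :: real measure))"
  proof -
    have "(\<lambda>z. fst z + snd z *\<^sub>R v) \<in> measurable (lborel \<Otimes>\<^sub>M lborel) borel"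
      by measurable
    from measurable_sets[OF this P] show ?thesis
      by (simp add: vimage_def Int_def conj_commute)
  qed
  ultimately have "AE t in lborel. AE x in lborel. P (x + t *\<^sub>R v)"
    by (subst (asm) lborel_pair.AE_commute) auto
  then obtain t :: real where "AE x in lborel. P (x + t *\<^sub>R v)"
    using eventually_happens[of _ "ae_filter (lborel :: real measure)"]
    by (auto simp: ae_filter_eq_bot_iff)
  then show ?thesis
    using AE_lborel_translate[OF P, of "t *\<^sub>R v"] by (simp add: P_def add.commute)
qed

section \<open>Additivity of the directional derivative almost everywhere\<close>

lemma AE_box_frontier:
  fixes a b :: "'a::euclidean_space"
  shows "AE x in lborel. x \<in> cbox a b \<longrightarrow> x \<in> box a b"
proof -
  have "negligible (cbox a b - box a b)" by (rule negligible_frontier_interval)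
  moreover have "cbox a b - box a b \<in> sets borel" by auto
  ultimately have "cbox a b - box a b \<in> null_sets lborel"
    by (simp add: negligible_iff_emeasure0 emeasure_completion null_sets_def)
  from AE_not_in[OF this] show ?thesis by eventually_elim auto
qed

text \<open>This is continuity of translation in the integral norm. For a box it is elementary: off
  the null frontier the translated indicator eventually equals the original one, and all translates
  live in one ball.\<close>

lemma box_translate_tendsto:
  fixes a b :: "'a::euclidean_space"
  assumes c: "c \<longlonglongrightarrow> 0"
  shows "(\<lambda>n. LINT x|lborel. \<bar>indicator (box a b) (x - c n) - indicator (box a b) x :: real\<bar>) \<longlonglongrightarrow> 0"
proof -
  obtain B where B: "\<And>n. norm (c n) \<le> B"
    using convergent_imp_Bseq[OF convergentI[OF c]] unfolding Bseq_def by blast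
  obtain R where R: "box a b \<subseteq> ball 0 R"
    using bounded_subset_ballD[OF bounded_box] by blast
  let ?f = "\<lambda>n x. \<bar>indicator (box a b) (x - c n) - indicator (box a b) x :: real\<bar>"
  have "(\<lambda>n. LINT x|lborel. ?f n x) \<longlonglongrightarrow> (LINT x|lborel. (\<lambda>x::'a. 0) x)"
  proof (rule integral_dominated_convergence[where w="indicator (ball 0 (R + B))"])
    show "AE x in lborel. (\<lambda>n. ?f n x) \<longlonglongrightarrow> 0"
      using AE_box_frontier[of a b]
    proof eventually_elim
      case (elim x)
      have lim: "(\<lambda>n. x - c n) \<longlonglongrightarrow> x"
        using tendsto_diff[OF tendsto_const[of x] c] by simp
      have "\<forall>\<^sub>F n in sequentially. ?f n x = 0"
      proof (cases "x \<in> box a b")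
        case True
        then have "\<forall>\<^sub>F n in sequentially. x - c n \<in> box a b"
          using lim open_box topological_tendstoD by blast
        then show ?thesis by eventually_elim (use True in auto)
      next
        case False
        then have "x \<in> - cbox a b" using elim by auto
        then have "\<forall>\<^sub>F n in sequentially. x - c n \<in> - cbox a b"
          using lim closed_cbox[of a b] open_Compl topological_tendstoD by blast
        then show ?thesis
          by eventually_elim (use False box_subset_cbox[of a b] in \<open>auto simp: indicator_def\<close>)
      qed
      then show ?case by (rule tendsto_eventually)
    qed
    show "AE x in lborel. norm (?f n x) \<le> indicator (ball 0 (R + B)) x" for n
    proof (intro AE_I2)
      fix x :: 'a
      have "x \<in> ball 0 (R + B)" if "x - c n \<in> box a b \<or> x \<in> box a b"
      proof -
        have "norm (x - c n) < R \<or> norm x < R" using that R by auto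
        then have "norm x < R + B"
          using B[of n] norm_ge_zero[of "c n"] norm_triangle_sub[of x "c n"] by linarith
        then show ?thesis by simp
      qed
      then show "norm (?f n x) \<le> indicator (ball 0 (R + B)) x"
        by (auto simp: indicator_def)
    qed
    show "integrable lborel (indicator (ball 0 (R + B)) :: 'a \<Rightarrow> real)"
      by (simp add: integrable_indicator_iff emeasure_bounded_finite[unfolded infinity_ennreal_def])
  qed auto
  then show ?thesis by simp
qed

text \<open>The density \<open>1 + g / K\<close> is nonnegative for large \<open>K\<close> and gives every box its Lebesgue measure.\<close>

lemma AE_eq_0_if_box_integrals_0:
  fixes g :: "'a::euclidean_space \<Rightarrow> real"
  assumes g[measurable]: "g \<in> borel_measurable borel"
    and bound: "AE x in lborel. \<bar>g x\<bar> \<le> C"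
    and zero: "\<And>a b. (LINT x|lborel. indicator (box a b) x * g x) = 0"
  shows "AE x in lborel. g x = 0"
proof -
  define K where "K = \<bar>C\<bar> + 1"
  have "K > 0" "C \<le> K" by (auto simp: K_def)
  define f where "f x = 1 + g x / K" for x
  have f[measurable]: "f \<in> borel_measurable borel" unfolding f_def by measurable
  have pos: "AE x in lborel. 0 \<le> f x"
    using bound
  proof eventually_elim
    case (elim x)
    then have "- g x \<le> K" using \<open>C \<le> K\<close> by linarith
    then show ?case using \<open>K > 0\<close> by (simp add: f_def field_simps)
  qed
  have "lborel = density lborel (\<lambda>x. ennreal (f x))"
  proof (rule lborel_eqI)
    fix l u :: 'a assume lu: "\<And>b. b \<in> Basis \<Longrightarrow> l \<bullet> b \<le> u \<bullet> b"
    have i1: "integrable lborel (indicator (box l u) :: 'a \<Rightarrow> real)"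
      by (simp add: integrable_indicator_iff emeasure_bounded_finite[unfolded infinity_ennreal_def])
    have i2: "integrable lborel (\<lambda>x. indicator (box l u) x * (g x / K))"
    proof (rule Bochner_Integration.integrable_bound[OF i1])
      show "AE x in lborel. norm (indicator (box l u) x * (g x / K)) \<le> norm (indicator (box l u) x :: real)"
        using bound
      proof eventually_elim
        case (elim x)
        then have "\<bar>g x / K\<bar> \<le> 1" using \<open>C \<le> K\<close> \<open>K > 0\<close> by simp
        then show ?case by (auto simp: indicator_def)
      qed
    qed measurable
    have eq: "indicator (box l u) x * f x = indicator (box l u) x + indicator (box l u) x * (g x / K)" for x
      by (simp add: f_def algebra_simps)
    have "emeasure (density lborel (\<lambda>x. ennreal (f x))) (box l u) = (\<integral>\<^sup>+x. ennreal (f x) * indicator (box l u) x \<partial>lborel)"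
      by (subst emeasure_density) auto
    also have "\<dots> = (\<integral>\<^sup>+x. ennreal (indicator (box l u) x * f x) \<partial>lborel)"
      by (intro nn_integral_cong) (auto simp: indicator_def)
    also have "\<dots> = ennreal (LINT x|lborel. indicator (box l u) x * f x)"
    proof (rule nn_integral_eq_integral)
      show "integrable lborel (\<lambda>x. indicator (box l u) x * f x)"
        unfolding eq using i1 i2 by (rule Bochner_Integration.integrable_add)
      show "AE x in lborel. 0 \<le> indicator (box l u) x * f x"
        using pos by eventually_elim auto
    qed
    also have "(LINT x|lborel. indicator (box l u) x * f x)
        = (LINT x|lborel. indicator (box l u) x) + (LINT x|lborel. indicator (box l u) x * (g x / K))"
      unfolding eq using i1 i2 by (rule Bochner_Integration.integral_add)
    also have "(LINT x|lborel. indicator (box l u) x * (g x / K)) = (LINT x|lborel. indicator (box l u) x * g x) / K"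
      by simp
    also have "\<dots> = 0" by (simp only: zero div_0)
    also have "(LINT x|lborel. indicator (box l u) x :: real) + 0 = (\<Prod>b\<in>Basis. (u - l) \<bullet> b)"
      using lu by (simp add: measure_lborel_box_eq)
    finally show "emeasure (density lborel (\<lambda>x. ennreal (f x))) (box l u) = ennreal (\<Prod>b\<in>Basis. (u - l) \<bullet> b)" .
  qed simp
  then have "density lborel (\<lambda>x. ennreal (f x)) = density lborel (\<lambda>x. 1)"
    by (simp add: density_1)
  \<comment> \<open>Densities with respect to a sigma-finite measure are unique almost
    everywhere.\<close>
  then have "AE x in lborel. ennreal (f x) = 1"
    by (subst (asm) sigma_finite_measure.density_unique_iff[OF sigma_finite_lborel]) auto
  then show ?thesis
    using pos
  proof eventually_elim
    case (elim x)
    then have "f x = 1" by (metis ennreal_1 ennreal_inj zero_le_one)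
    then show ?case using \<open>K > 0\<close> by (simp add: f_def)
  qed
qed

lemma lipschitz_AE_has_dir_deriv:
  fixes u :: "'a::euclidean_space \<Rightarrow> real"
  assumes "L-lipschitz_on UNIV u"
  shows "AE x in lborel. ((\<lambda>t. u (x + t *\<^sub>R v)) has_real_derivative dir_deriv u v x) (at 0)"
  using lipschitz_AE_directional_differentiable[OF assms, of v]
proof eventually_elim
  case (elim x)
  then obtain D where "((\<lambda>t. u (x + t *\<^sub>R v)) has_real_derivative D) (at 0)"
    by (auto simp: real_differentiable_def)
  with dir_deriv_eq[OF this] show ?case by simp
qed

lemma abs_dir_deriv_le:
  fixes u :: "'a::euclidean_space \<Rightarrow> real"
  assumes lip: "L-lipschitz_on UNIV u"
    and d: "((\<lambda>t. u (x + t *\<^sub>R v)) has_real_derivative dir_deriv u v x) (at 0)"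
  shows "\<bar>dir_deriv u v x\<bar> \<le> L * norm v"
proof (rule LIMSEQ_le_const2)
  show "(\<lambda>n. \<bar>dquot u v n x\<bar>) \<longlonglongrightarrow> \<bar>dir_deriv u v x\<bar>"
    by (intro tendsto_rabs dquot_tendsto d)
qed (use abs_dquot_le[OF lip] in auto)

text \<open>The difference quotient for \<open>v + w\<close> minus the one for \<open>v\<close> is the one for \<open>w\<close> translated by \<open>v / n\<close>,
  and such a translation changes integrals over boxes only by \<open>o(1)\<close>.\<close>

lemma dir_deriv_add_AE:
  fixes u :: "'a::euclidean_space \<Rightarrow> real"
  assumes lip: "L-lipschitz_on UNIV u"
  shows "AE x in lborel. dir_deriv u (v + w) x = dir_deriv u v x + dir_deriv u w x"
proof -
  have u: "continuous_on UNIV u" using lip by (rule lipschitz_on_continuous_on)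
  note [measurable] = dquot_measurable[OF u] dir_deriv_measurable[OF u]
  define g where "g x = dir_deriv u (v + w) x - dir_deriv u v x - dir_deriv u w x" for x
  define q where "q n x = dquot u (v + w) n x - dquot u v n x - dquot u w n x" for n x
  define C where "C = L * norm (v + w) + L * norm v + L * norm w"
  have q_bound: "\<bar>q n x\<bar> \<le> C" for n x
    using abs_dquot_le[OF lip, of "v + w" n x] abs_dquot_le[OF lip, of v n x] abs_dquot_le[OF lip, of w n x]
    unfolding q_def C_def by linarith
  have q_lim: "AE x in lborel. (\<lambda>n. q n x) \<longlonglongrightarrow> g x"
    using lipschitz_AE_has_dir_deriv[OF lip, of "v + w"] lipschitz_AE_has_dir_deriv[OF lip, of v]
      lipschitz_AE_has_dir_deriv[OF lip, of w]
    by eventually_elim (auto simp: q_def g_def intro!: tendsto_diff dquot_tendsto)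
  have "AE x in lborel. g x = 0"
  proof (rule AE_eq_0_if_box_integrals_0)
    show "g \<in> borel_measurable borel" unfolding g_def by measurable
    show "AE x in lborel. \<bar>g x\<bar> \<le> C"
      using q_lim
    proof eventually_elim
      case (elim x)
      show ?case
        by (rule LIMSEQ_le_const2[OF tendsto_rabs[OF elim]]) (use q_bound in auto)
    qed
    fix a b :: 'a
    let ?I = "indicator (box a b) :: 'a \<Rightarrow> real"
    have int_I: "integrable lborel ?I"
      by (simp add: integrable_indicator_iff emeasure_bounded_finite[unfolded infinity_ennreal_def])
    have "(\<lambda>n. LINT x|lborel. ?I x * q n x) \<longlonglongrightarrow> (LINT x|lborel. ?I x * g x)"
    proof (rule integral_dominated_convergence[where w="\<lambda>x. C * ?I x"])
      show "(\<lambda>x. ?I x * g x) \<in> borel_measurable lborel" unfolding g_def by measurable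
      show "(\<lambda>x. ?I x * q n x) \<in> borel_measurable lborel" for n unfolding q_def by measurable
      show "AE x in lborel. (\<lambda>n. ?I x * q n x) \<longlonglongrightarrow> ?I x * g x"
        using q_lim by eventually_elim (intro tendsto_intros)
      show "AE x in lborel. norm (?I x * q n x) \<le> C * ?I x" for n
        using q_bound by (auto simp: indicator_def abs_mult)
    qed (use int_I in simp)
    moreover have "(\<lambda>n. LINT x|lborel. ?I x * q n x) \<longlonglongrightarrow> 0"
    proof (rule Lim_null_comparison)
      define c where "c n = (1 / real (Suc n)) *\<^sub>R v" for n
      have "(\<lambda>n. 1 / real (Suc n)) \<longlonglongrightarrow> 0"
        using lim_1_over_n[THEN LIMSEQ_Suc] by auto
      then have c: "c \<longlonglongrightarrow> 0"
        unfolding c_def using tendsto_scaleR[of _ 0 sequentially "\<lambda>_. v" v] by simp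
      show "(\<lambda>n. (LINT x|lborel. \<bar>?I (x - c n) - ?I x\<bar>) * (L * norm w)) \<longlonglongrightarrow> 0"
        using tendsto_mult_right[OF box_translate_tendsto[OF c, of a b], of "L * norm w"] by simp
      have int_shift: "integrable lborel (\<lambda>x. ?I (x - c n))" for n
      proof -
        have "integrable (distr lborel borel ((+) (- c n))) ?I"
          using int_I by (simp add: lborel_distr_plus)
        then show ?thesis
          by (subst (asm) integrable_distr_eq) auto
      qed
      have "\<bar>LINT x|lborel. ?I x * q n x\<bar> \<le> (LINT x|lborel. \<bar>?I (x - c n) - ?I x\<bar>) * (L * norm w)" for n
      proof -
        let ?h = "dquot u w n"
        have h: "norm (J x * ?h x) \<le> norm (L * norm w * J x)" for J :: "'a \<Rightarrow> real" and x
          using mult_left_mono[OF abs_dquot_le[OF lip, of w n x], of "\<bar>J x\<bar>"] lipschitz_on_nonneg[OF lip]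
          by (simp add: abs_mult mult_ac)
        have int_h: "integrable lborel (\<lambda>x. J x * ?h x)" if "integrable lborel J" for J
          using that by (intro Bochner_Integration.integrable_bound[OF _ _ AE_I2[OF h]]) (auto intro: borel_measurable_integrable)
        have q_eq: "q n x = ?h (c n + x) - ?h x" for x
          by (simp add: q_def dquot_def c_def algebra_simps)
        \<comment> \<open>The change of variables moves the translation from \<open>?h\<close>,
          whose modulus of continuity is not controlled uniformly in \<open>n\<close>, to the
          indicator of a fixed box; of \<open>?h\<close> only the uniform bound is then
          needed.\<close>
        have shift_eq: "(LINT x|lborel. ?I (x - c n) * ?h x) = (LINT x|lborel. ?I x * ?h (c n + x))"
        proof -
          have "(LINT x|lborel. ?I (x - c n) * ?h x) = (LINT x|distr lborel borel ((+) (c n)). ?I (x - c n) * ?h x)"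
            by (simp add: lborel_distr_plus)
          also have "\<dots> = (LINT x|lborel. ?I x * ?h (c n + x))"
            by (subst integral_distr) auto
          finally show ?thesis .
        qed
        have int_hs: "integrable lborel (\<lambda>x. ?I x * ?h (c n + x))"
        proof -
          have "integrable (distr lborel borel ((+) (c n))) (\<lambda>x. ?I (x - c n) * ?h x)"
            using int_h[OF int_shift] by (simp add: lborel_distr_plus)
          then show ?thesis by (subst (asm) integrable_distr_eq) auto
        qed
        have "(LINT x|lborel. ?I x * q n x) = (LINT x|lborel. ?I x * ?h (c n + x) - ?I x * ?h x)"
          by (simp add: q_eq algebra_simps)
        also have "\<dots> = (LINT x|lborel. ?I (x - c n) * ?h x) - (LINT x|lborel. ?I x * ?h x)"
          unfolding shift_eq by (rule Bochner_Integration.integral_diff[OF int_hs int_h[OF int_I]])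
        also have "\<dots> = (LINT x|lborel. (?I (x - c n) - ?I x) * ?h x)"
          by (subst Bochner_Integration.integral_diff[symmetric, OF int_h[OF int_shift] int_h[OF int_I]])
            (simp add: algebra_simps)
        also have "\<bar>\<dots>\<bar> \<le> (LINT x|lborel. \<bar>?I (x - c n) - ?I x\<bar> * (L * norm w))"
        proof (rule order_trans[OF integral_abs_bound], rule integral_mono)
          have d: "integrable lborel (\<lambda>x. ?I (x - c n) - ?I x)"
            by (intro Bochner_Integration.integrable_diff int_shift int_I)
          show "integrable lborel (\<lambda>x. \<bar>(?I (x - c n) - ?I x) * ?h x\<bar>)"
            by (intro integrable_abs int_h[OF d])
          show "integrable lborel (\<lambda>x. \<bar>?I (x - c n) - ?I x\<bar> * (L * norm w))"
            using d by (intro integrable_mult_left integrable_abs)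
          show "\<bar>(?I (x - c n) - ?I x) * ?h x\<bar> \<le> \<bar>?I (x - c n) - ?I x\<bar> * (L * norm w)" for x
            using abs_dquot_le[OF lip, of w n x] by (simp add: abs_mult mult_left_mono)
        qed
        finally show ?thesis by simp
      qed
      then show "\<forall>\<^sub>F n in sequentially. norm (LINT x|lborel. ?I x * q n x) \<le> (LINT x|lborel. \<bar>?I (x - c n) - ?I x\<bar>) * (L * norm w)"
        by (auto simp: real_norm_def)
    qed
    ultimately show "(LINT x|lborel. ?I x * g x) = 0"
      by (rule LIMSEQ_unique)
  qed
  then show ?thesis by eventually_elim (simp add: g_def)
qed

section \<open>Rademacher's theorem\<close>

text \<open>Countability lets the exceptional null sets of all these directions be united; density
  and closure under addition are what the linear extension uses.\<close>

definition rational_vectors :: "'a::euclidean_space set" where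
  "rational_vectors = {v. \<forall>b\<in>Basis. v \<bullet> b \<in> \<rat>}"

lemma countable_rational_vectors: "countable (rational_vectors :: 'a::euclidean_space set)"
proof (rule countable_subset)
  show "rational_vectors \<subseteq> (\<lambda>f. \<Sum>b\<in>Basis. f b *\<^sub>R (b::'a)) ` (Basis \<rightarrow>\<^sub>E \<rat>)"
  proof
    fix v :: 'a assume "v \<in> rational_vectors"
    then have "restrict ((\<bullet>) v) Basis \<in> Basis \<rightarrow>\<^sub>E \<rat>"
      by (auto simp: rational_vectors_def)
    moreover have "v = (\<Sum>b\<in>Basis. restrict ((\<bullet>) v) Basis b *\<^sub>R b)"
      by (simp add: euclidean_representation)
    ultimately show "v \<in> (\<lambda>f. \<Sum>b\<in>Basis. f b *\<^sub>R (b::'a)) ` (Basis \<rightarrow>\<^sub>E \<rat>)"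
      by blast
  qed
  show "countable ((\<lambda>f. \<Sum>b\<in>Basis. f b *\<^sub>R (b::'a)) ` (Basis \<rightarrow>\<^sub>E \<rat>))"
    by (intro countable_image countable_PiE countable_rat) auto
qed

lemma rational_vectors_dense:
  fixes v :: "'a::euclidean_space"
  assumes "e > 0"
  shows "\<exists>w\<in>rational_vectors. dist w v < e"
proof -
  define d where "d = e / DIM('a)"
  have "d > 0" using assms by (simp add: d_def)
  have "\<exists>q. q \<in> \<rat> \<and> \<bar>q - v \<bullet> b\<bar> < d" for b
    using Rats_dense_in_real[of "v \<bullet> b" "v \<bullet> b + d"] \<open>d > 0\<close> by (auto simp: abs_less_iff)
  then obtain q where q: "\<And>b. q b \<in> \<rat>" "\<And>b. \<bar>q b - v \<bullet> b\<bar> < d" by metis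
  define w where "w = (\<Sum>b\<in>Basis. q b *\<^sub>R b)"
  have wb: "w \<bullet> b = q b" if "b \<in> Basis" for b
    using that by (simp add: w_def)
  have "norm (w - v) \<le> (\<Sum>b\<in>Basis. \<bar>(w - v) \<bullet> b\<bar>)" by (rule norm_le_l1)
  also have "\<dots> < (\<Sum>b\<in>(Basis :: 'a set). d)"
    by (intro sum_strict_mono) (auto simp: inner_diff_left wb q(2))
  also have "\<dots> = e" by (simp add: d_def)
  finally have "dist w v < e" by (simp add: dist_norm)
  moreover have "w \<in> rational_vectors" using q(1) by (auto simp: rational_vectors_def wb)
  ultimately show ?thesis by blast
qed

lemma has_derivative_imp_directional:
  assumes "(u has_derivative (\<lambda>h. p \<bullet> h)) (at x)"
  shows "((\<lambda>t. u (x + t *\<^sub>R v)) has_real_derivative p \<bullet> v) (at 0)"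
proof -
  have "((\<lambda>t::real. x + t *\<^sub>R v) has_derivative (\<lambda>t. t *\<^sub>R v)) (at 0)"
    by (auto intro!: derivative_eq_intros)
  moreover have "(u has_derivative (\<lambda>h. p \<bullet> h)) (at (x + 0 *\<^sub>R v))"
    using assms by simp
  ultimately have "((\<lambda>t. u (x + t *\<^sub>R v)) has_derivative (\<lambda>t. p \<bullet> (t *\<^sub>R v))) (at 0)"
    by (rule has_derivative_compose)
  moreover have "(\<lambda>t. p \<bullet> (t *\<^sub>R v)) = (*) (p \<bullet> v)" by (auto simp: mult.commute)
  ultimately show ?thesis
    by (simp only: has_field_derivative_def)
qed

text \<open>Compactness of the unit sphere leaves finitely many directions of \<open>Q\<close> to
  control, so their expansions hold with a common radius. Any other direction is replaced by a
  nearby one of these, at a cost that the Lipschitz bound makes proportional to the distance from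
  \<open>x\<close>.\<close>

lemma has_derivative_if_directional:
  fixes u :: "'a::euclidean_space \<Rightarrow> real"
  assumes lip: "L-lipschitz_on UNIV u"
    and dense: "\<And>v e. e > 0 \<Longrightarrow> \<exists>w\<in>Q. dist w v < e"
    and dir: "\<And>v. v \<in> Q \<Longrightarrow> ((\<lambda>t. u (x + t *\<^sub>R v)) has_real_derivative p \<bullet> v) (at 0)"
  shows "(u has_derivative (\<lambda>h. p \<bullet> h)) (at x)"
  unfolding has_derivative_at_alt
proof (intro conjI allI impI)
  show "bounded_linear ((\<bullet>) p)" by (rule bounded_linear_inner_right)
  fix e :: real assume "e > 0"
  have "0 \<le> L" using lip lipschitz_on_nonneg by blast
  \<comment> \<open>The denominator collects three errors: \<open>L\<close> from moving the point,
    \<open>norm p\<close> from moving the direction in the linear term, and 1 from the expansion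
    along the chosen direction.\<close>
  define e' where "e' = e / (L + norm p + 1)"
  have pos: "L + norm p + 1 > 0" using \<open>0 \<le> L\<close> by (simp add: add_nonneg_pos)
  then have "e' > 0" using \<open>e > 0\<close> by (simp add: e'_def)
  have "compact (sphere (0::'a) 1)" by simp
  moreover have "sphere (0::'a) 1 \<subseteq> (\<Union>w\<in>Q. ball w e')"
    using dense[OF \<open>e' > 0\<close>] by (force simp: dist_commute)
  ultimately obtain F where F: "F \<subseteq> Q" "finite F" "sphere (0::'a) 1 \<subseteq> (\<Union>w\<in>F. ball w e')"
    by (rule compactE_image[OF _ open_ball])
  have "\<exists>d>0. \<forall>t. \<bar>t\<bar> < d \<longrightarrow> \<bar>u (x + t *\<^sub>R w) - u x - t * (p \<bullet> w)\<bar> \<le> e' * \<bar>t\<bar>" if "w \<in> F" for w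
  proof -
    have "((\<lambda>t. u (x + t *\<^sub>R w)) has_derivative (*) (p \<bullet> w)) (at 0)"
      using dir[of w] that F(1) by (auto simp: has_field_derivative_def)
    then show ?thesis
      using \<open>e' > 0\<close> unfolding has_derivative_at_alt by (auto simp: mult.commute)
  qed
  then obtain d where d: "\<And>w. w \<in> F \<Longrightarrow> d w > 0"
    "\<And>w t. w \<in> F \<Longrightarrow> \<bar>t\<bar> < d w \<Longrightarrow> \<bar>u (x + t *\<^sub>R w) - u x - t * (p \<bullet> w)\<bar> \<le> e' * \<bar>t\<bar>"
    by metis
  \<comment> \<open>The extra element 1 keeps the minimum over a nonempty set without a separate
    case.\<close>
  define \<delta> where "\<delta> = Min (insert 1 (d ` F))"
  have \<delta>: "\<delta> > 0" "\<And>w. w \<in> F \<Longrightarrow> \<delta> \<le> d w"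
    using F(2) d(1) by (auto simp: \<delta>_def)
  have "norm (u y - u x - p \<bullet> (y - x)) \<le> e * norm (y - x)" if y: "norm (y - x) < \<delta>" for y
  proof (cases "y = x")
    case False
    define t where "t = norm (y - x)"
    define z where "z = (y - x) /\<^sub>R t"
    have t: "t > 0" using False by (simp add: t_def)
    have "z \<in> sphere 0 1" using t by (simp add: z_def t_def)
    then obtain w where w: "w \<in> F" "dist w z < e'" using F(3) by auto
    have y_eq: "y = x + t *\<^sub>R z" using t by (simp add: z_def)
    have 1: "\<bar>u (x + t *\<^sub>R w) - u x - t * (p \<bullet> w)\<bar> \<le> e' * t"
      using d(2)[OF w(1), of t] \<delta>(2)[OF w(1)] y t by (simp add: t_def)
    have "\<bar>u y - u (x + t *\<^sub>R w)\<bar> \<le> L * norm (t *\<^sub>R (z - w))"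
      using lipschitz_onD[OF lip, of y "x + t *\<^sub>R w"] by (simp add: y_eq dist_norm scaleR_diff_right)
    also have "\<dots> = L * (t * dist w z)"
      using t by (simp add: dist_norm norm_minus_commute)
    also have "\<dots> \<le> L * (t * e')"
      using w(2) t \<open>0 \<le> L\<close> by (intro mult_left_mono) auto
    finally have 2: "\<bar>u y - u (x + t *\<^sub>R w)\<bar> \<le> L * (t * e')" .
    have "\<bar>t * (p \<bullet> (w - z))\<bar> \<le> t * (norm p * norm (w - z))"
      using t by (simp add: abs_mult Cauchy_Schwarz_ineq2)
    also have "\<dots> \<le> t * (norm p * e')"
      using w(2) t by (intro mult_left_mono) (auto simp: dist_norm)
    finally have 3: "\<bar>t * (p \<bullet> (w - z))\<bar> \<le> t * (norm p * e')" .
    have "u y - u x - p \<bullet> (y - x) = (u y - u (x + t *\<^sub>R w)) + (u (x + t *\<^sub>R w) - u x - t * (p \<bullet> w)) + t * (p \<bullet> (w - z))"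
      by (simp add: y_eq inner_diff_right algebra_simps)
    then have "\<bar>u y - u x - p \<bullet> (y - x)\<bar> \<le> L * (t * e') + e' * t + t * (norm p * e')"
      using 1 2 3 by linarith
    also have "\<dots> = (L + norm p + 1) * e' * t" by (simp add: algebra_simps)
    also have "\<dots> = e * t" using pos by (simp add: e'_def)
    finally show ?thesis by (simp add: t_def)
  qed auto
  then show "\<exists>d>0. \<forall>y. norm (y - x) < d \<longrightarrow> norm (u y - u x - p \<bullet> (y - x)) \<le> e * norm (y - x)"
    using \<delta>(1) by blast
qed

text \<open>Off one null set the directional derivative is additive on rational vectors and
  homogeneous wherever it exists, so there it is the inner product with the vector \<open>p\<close>
  of derivatives along the basis. Density of these directions upgrades this to a total
  derivative.\<close>

theorem Rademacher:
  fixes u :: "'a::euclidean_space \<Rightarrow> real"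
  assumes lip: "L-lipschitz_on UNIV u"
  shows "AE x in lborel. \<exists>p. (u has_derivative (\<lambda>h. p \<bullet> h)) (at x)"
proof -
  let ?Q = "rational_vectors :: 'a set"
  have "AE x in lborel. \<forall>v\<in>?Q. ((\<lambda>t. u (x + t *\<^sub>R v)) has_real_derivative dir_deriv u v x) (at 0)"
    unfolding AE_ball_countable[OF countable_rational_vectors]
    using lipschitz_AE_has_dir_deriv[OF lip] by blast
  moreover have "AE x in lborel. \<forall>v\<in>?Q. \<forall>w\<in>?Q. dir_deriv u (v + w) x = dir_deriv u v x + dir_deriv u w x"
    unfolding AE_ball_countable[OF countable_rational_vectors]
    using dir_deriv_add_AE[OF lip] by blast
  ultimately show ?thesis
  proof eventually_elim
    case (elim x)
    define f where "f v = dir_deriv u v x" for v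
    have d: "((\<lambda>t. u (x + t *\<^sub>R v)) has_real_derivative f v) (at 0)" if "v \<in> ?Q" for v
      using elim(1) that by (auto simp: f_def)
    have add: "f (v + w) = f v + f w" if "v \<in> ?Q" "w \<in> ?Q" for v w
      using elim(2) that by (auto simp: f_def)
    \<comment> \<open>Homogeneity holds pointwise by the chain rule, for all real \<open>c\<close>,
      and costs no further null set.\<close>
    have scale: "f (c *\<^sub>R v) = c * f v" if "v \<in> ?Q" for c v
    proof -
      have "((\<lambda>t. u (x + (c * t) *\<^sub>R v)) has_real_derivative f v * c) (at 0)"
        using d[OF that] by (intro DERIV_chain2[where g="\<lambda>t. c * t" and f="\<lambda>t. u (x + t *\<^sub>R v)"])
          (auto intro!: derivative_eq_intros)
      then show ?thesis
        unfolding f_def by (intro dir_deriv_eq) (simp add: mult_ac)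
    qed
    define p where "p = (\<Sum>b\<in>Basis. f b *\<^sub>R b)"
    have Q_b: "c *\<^sub>R b \<in> ?Q" if "b \<in> Basis" "c \<in> \<rat>" for b c
      using that by (auto simp: rational_vectors_def inner_Basis)
    have "f v = p \<bullet> v" if v: "v \<in> ?Q" for v
    proof -
      \<comment> \<open>The induction also carries membership of the partial sums, because
        additivity is available only between rational vectors.\<close>
      have "(\<Sum>b\<in>B. (v \<bullet> b) *\<^sub>R b) \<in> ?Q \<and> f (\<Sum>b\<in>B. (v \<bullet> b) *\<^sub>R b) = (\<Sum>b\<in>B. (v \<bullet> b) * f b)"
        if "finite B" "B \<subseteq> Basis" for B
        using that
      proof (induction B)
        case empty
        have "0 \<in> ?Q" by (simp add: rational_vectors_def)
        with scale[OF this, of 0] show ?case by simp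
      next
        case (insert b B)
        have b: "(v \<bullet> b) *\<^sub>R b \<in> ?Q" "b \<in> ?Q"
          using v insert.prems Q_b[of b "v \<bullet> b"] Q_b[of b 1] by (auto simp: rational_vectors_def)
        have IH: "(\<Sum>b\<in>B. (v \<bullet> b) *\<^sub>R b) \<in> ?Q" "f (\<Sum>b\<in>B. (v \<bullet> b) *\<^sub>R b) = (\<Sum>b\<in>B. (v \<bullet> b) * f b)"
          using insert by auto
        have "(v \<bullet> b) *\<^sub>R b + (\<Sum>b\<in>B. (v \<bullet> b) *\<^sub>R b) \<in> ?Q"
          using b(1) IH(1) by (auto simp: rational_vectors_def inner_add_left)
        then show ?case
          using insert.hyps add[OF b(1) IH(1)] scale[OF b(2)] IH(2) by simp
      qed
      from this[OF finite_Basis subset_refl] have "f v = (\<Sum>b\<in>Basis. (v \<bullet> b) * f b)"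
        by (simp add: euclidean_representation)
      also have "\<dots> = p \<bullet> v"
        by (subst inner_commute) (simp add: p_def inner_sum_right mult.commute)
      finally show ?thesis .
    qed
    then have "(u has_derivative (\<lambda>h. p \<bullet> h)) (at x)"
      using d by (intro has_derivative_if_directional[OF lip rational_vectors_dense]) auto
    then show ?case by blast
  qed
qed

section \<open>Gradients of mollifications\<close>

text \<open>Reflection preserves Lebesgue measure; this carries null sets of base points over to the
  integration variable of a convolution.\<close>

lemma AE_lborel_reflect:
  fixes c :: "'a::euclidean_space"
  assumes "AE x in lborel. P x"
  shows "AE x in lborel. P (c - x)"
proof -
  have "distr lborel borel (\<lambda>x. c - x) = (lborel :: 'a measure)"
    using lborel_affine[of "-1" c] by (simp add: density_1)
  with assms have "AE x in distr lborel borel (\<lambda>x. c - x). P x" by (simp only:)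
  then show ?thesis by (rule AE_distrD[rotated]) simp
qed

text \<open>Difference quotients commute with the convolution, so all differentiation falls on
  \<open>U\<close> and none on \<open>\<phi>\<close>. In the limit \<open>p \<bullet> v\<close> is
  the average of the directional derivatives of \<open>U\<close> over the support of
  \<open>\<phi>\<close>, and an average inherits the lower bound.\<close>

lemma mollified_derivative_lower_bound:
  fixes U :: "'a::euclidean_space \<Rightarrow> real"
  assumes lip: "L-lipschitz_on UNIV U"
    and \<phi>: "integrable lborel \<phi>" "\<And>y. 0 \<le> \<phi> y" "(LINT y|lborel. \<phi> y) = 1"
    and supp: "\<And>y. \<phi> y \<noteq> 0 \<Longrightarrow> norm y \<le> s"
    and lower: "\<And>q y. \<lbrakk>(U has_derivative (\<lambda>h. q \<bullet> h)) (at y); dist y \<xi> \<le> s\<rbrakk> \<Longrightarrow> b \<le> v \<bullet> q"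
    and der: "((\<lambda>z. LINT y|lborel. U (z - y) * \<phi> y) has_derivative (\<lambda>h. p \<bullet> h)) (at \<xi>)"
  shows "b \<le> v \<bullet> p"
proof -
  let ?V = "\<lambda>z. LINT y|lborel. U (z - y) * \<phi> y"
  have U: "continuous_on UNIV U" using lip by (rule lipschitz_on_continuous_on)
  have [measurable]: "U \<in> borel_measurable borel" using U by (rule borel_measurable_continuous_onI)
  have [measurable]: "\<phi> \<in> borel_measurable borel" using \<phi>(1) by (auto dest: borel_measurable_integrable)
  note [measurable] = dquot_measurable[OF U] dir_deriv_measurable[OF U]
  have "0 \<le> L" using lip lipschitz_on_nonneg by blast
  \<comment> \<open>\<open>U\<close> may be unbounded, but where \<open>\<phi>\<close> is nonzero it
    differs from \<open>U z\<close> by at most \<open>L * s\<close>.\<close>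
  have int: "integrable lborel (\<lambda>y. U (z - y) * \<phi> y)" for z
  proof (rule Bochner_Integration.integrable_bound)
    show "integrable lborel (\<lambda>y. (\<bar>U z\<bar> + L * s) * \<phi> y)" using \<phi>(1) by simp
    have "norm (U (z - y) * \<phi> y) \<le> norm ((\<bar>U z\<bar> + L * s) * \<phi> y)" for y
    proof (cases "\<phi> y = 0")
      case False
      have "\<bar>U (z - y) - U z\<bar> \<le> L * norm y"
        using lipschitz_onD[OF lip, of "z - y" z] by (simp add: dist_norm)
      also have "\<dots> \<le> L * s" using supp[OF False] \<open>0 \<le> L\<close> by (rule mult_left_mono)
      finally have "\<bar>U (z - y)\<bar> \<le> \<bar>\<bar>U z\<bar> + L * s\<bar>" by linarith
      then show ?thesis by (simp add: abs_mult mult_right_mono)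
    qed simp
    then show "AE y in lborel. norm (U (z - y) * \<phi> y) \<le> norm ((\<bar>U z\<bar> + L * s) * \<phi> y)"
      by simp
  qed measurable
  have quot: "dquot ?V v k \<xi> = (LINT y|lborel. dquot U v k (\<xi> - y) * \<phi> y)" for k
  proof -
    let ?c = "(1 / real (Suc k)) *\<^sub>R v"
    have "dquot ?V v k \<xi> = (LINT y|lborel. U (\<xi> + ?c - y) * \<phi> y - U (\<xi> - y) * \<phi> y) * real (Suc k)"
      unfolding dquot_def by (subst Bochner_Integration.integral_diff[OF int int]) simp
    also have "\<dots> = (LINT y|lborel. (U (\<xi> + ?c - y) * \<phi> y - U (\<xi> - y) * \<phi> y) * real (Suc k))"
      by simp
    also have "\<dots> = (LINT y|lborel. dquot U v k (\<xi> - y) * \<phi> y)"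
      by (intro Bochner_Integration.integral_cong) (auto simp: dquot_def algebra_simps)
    finally show ?thesis .
  qed
  \<comment> \<open>Total differentiability is needed here, not just the derivative along
    \<open>v\<close>, because \<open>lower\<close> speaks of gradients.\<close>
  have ae: "AE y in lborel. \<exists>q. (U has_derivative (\<lambda>h. q \<bullet> h)) (at (\<xi> - y))"
    using AE_lborel_reflect[OF Rademacher[OF lip]] by simp
  have bound: "norm (dquot U v k (\<xi> - y) * \<phi> y) \<le> L * norm v * \<phi> y" for k y
    using mult_right_mono[OF abs_dquot_le[OF lip, of v k "\<xi> - y"] \<phi>(2)[of y]] \<phi>(2)[of y]
    by (simp add: abs_mult)
  have lim: "AE y in lborel. (\<lambda>k. dquot U v k (\<xi> - y) * \<phi> y) \<longlonglongrightarrow> dir_deriv U v (\<xi> - y) * \<phi> y"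
    using ae
  proof eventually_elim
    case (elim y)
    then obtain q where q: "((\<lambda>t. U (\<xi> - y + t *\<^sub>R v)) has_real_derivative q \<bullet> v) (at 0)"
      using has_derivative_imp_directional by blast
    show ?case
      using dquot_tendsto[OF q] dir_deriv_eq[OF q] by (auto intro: tendsto_intros)
  qed
  have dom: "integrable lborel (\<lambda>y. L * norm v * \<phi> y)" using \<phi>(1) by simp
  have meas: "(\<lambda>y. dir_deriv U v (\<xi> - y) * \<phi> y) \<in> borel_measurable lborel"
    "(\<lambda>y. dquot U v k (\<xi> - y) * \<phi> y) \<in> borel_measurable lborel" for k
    by measurable
  have conv: "(\<lambda>k. dquot ?V v k \<xi>) \<longlonglongrightarrow> (LINT y|lborel. dir_deriv U v (\<xi> - y) * \<phi> y)"
    unfolding quot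
    by (rule integral_dominated_convergence[OF meas dom lim]) (use bound in simp)
  have "(\<lambda>k. dquot ?V v k \<xi>) \<longlonglongrightarrow> p \<bullet> v"
    by (rule dquot_tendsto[OF has_derivative_imp_directional[OF der]])
  with conv have "p \<bullet> v = (LINT y|lborel. dir_deriv U v (\<xi> - y) * \<phi> y)"
    using LIMSEQ_unique by blast
  moreover have "(LINT y|lborel. b * \<phi> y) \<le> (LINT y|lborel. dir_deriv U v (\<xi> - y) * \<phi> y)"
  proof (rule integral_mono_AE)
    show "integrable lborel (\<lambda>y. b * \<phi> y)" using \<phi>(1) by simp
    show "integrable lborel (\<lambda>y. dir_deriv U v (\<xi> - y) * \<phi> y)"
      by (rule integrable_dominated_convergence[OF meas dom lim]) (use bound in simp)
    show "AE y in lborel. b * \<phi> y \<le> dir_deriv U v (\<xi> - y) * \<phi> y"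
      using ae
    proof eventually_elim
      case (elim y)
      then obtain q where q: "(U has_derivative (\<lambda>h. q \<bullet> h)) (at (\<xi> - y))" by blast
      show ?case
      proof (cases "\<phi> y = 0")
        case False
        then have "b \<le> v \<bullet> q" using supp by (intro lower[OF q]) (simp add: dist_norm)
        also have "\<dots> = dir_deriv U v (\<xi> - y)"
          using dir_deriv_eq[OF has_derivative_imp_directional[OF q, of v]] by (simp add: inner_commute)
        finally show ?thesis using \<phi>(2) by (rule mult_right_mono)
      qed simp
    qed
  qed
  ultimately show ?thesis using \<phi>(3) by (simp add: inner_commute)
qed

section \<open>Return to the torus: gradients, mollifiers and the limit\<close>

text \<open>Off \<open>x\<close> the divisor \<open>norm (y - x)\<close> is nonzero, so the little-o
  condition is the limit in the Frechet derivative of the periodic lift. Through this bridge the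
  Euclidean results apply.\<close>

lemma grad_graph_iff:
  "(X, p) \<in> grad_graph u \<longleftrightarrow>
    (\<exists>x. X = to_torus x \<and> ((\<lambda>y. u (to_torus y)) has_derivative (\<lambda>h. p \<bullet> h)) (at x))"
proof -
  have "f \<in> o[at x](\<lambda>y. norm (y - x)) \<longleftrightarrow> ((\<lambda>y. f y /\<^sub>R norm (y - x)) \<longlongrightarrow> 0) (at x)"
    for f :: "real ^ 'a \<Rightarrow> real" and x
  proof
    assume "f \<in> o[at x](\<lambda>y. norm (y - x))"
    from smalloD_tendsto[OF this] show "((\<lambda>y. f y /\<^sub>R norm (y - x)) \<longlongrightarrow> 0) (at x)"
      by (simp add: divide_inverse mult.commute)
  next
    assume "((\<lambda>y. f y /\<^sub>R norm (y - x)) \<longlongrightarrow> 0) (at x)"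
    then show "f \<in> o[at x](\<lambda>y. norm (y - x))"
      by (intro smalloI_tendsto) (simp_all add: divide_inverse mult.commute eventually_at_filter)
  qed
  then show ?thesis
    unfolding grad_graph_def has_derivative_at_within
    by (simp add: bounded_linear_inner_right)
qed

text \<open>The vector \<open>x - y\<close> is one of the competitors in the infimum that defines
  the torus distance.\<close>

lemma dist_to_torus_le: "dist (to_torus x) (to_torus y) \<le> dist x y"
proof (rule dense_ge)
  fix e assume "dist x y < e"
  then have "dist (to_torus x) (to_torus y) < e"
    unfolding dist_torus_less_iff by (intro exI[of _ "x - y"]) (simp add: to_torus_diff dist_norm)
  then show "dist (to_torus x) (to_torus y) \<le> e" by simp
qed

text \<open>The derivative along \<open>q\<close> itself is \<open>q \<bullet> q\<close>, and the
  Lipschitz bound limits it by \<open>L * norm q\<close>.\<close>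

lemma grad_norm_le:
  fixes U :: "'a::euclidean_space \<Rightarrow> real"
  assumes lip: "L-lipschitz_on UNIV U" and d: "(U has_derivative (\<lambda>h. q \<bullet> h)) (at x)"
  shows "norm q \<le> L"
proof -
  have r: "((\<lambda>t. U (x + t *\<^sub>R q)) has_real_derivative q \<bullet> q) (at 0)"
    using d by (rule has_derivative_imp_directional)
  then have "\<bar>q \<bullet> q\<bar> \<le> L * norm q"
    using abs_dir_deriv_le[OF lip, of x q] dir_deriv_eq[OF r] by simp
  then have "norm q * norm q \<le> L * norm q"
    by (simp add: dot_square_norm power2_eq_square)
  then show ?thesis
    using lipschitz_on_nonneg[OF lip] by (cases "q = 0") auto
qed

lemma mollifier_properties:
  fixes \<eta> :: "real ^ 'n::finite \<Rightarrow> real"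
  assumes \<eta>: "friedrichs_kernel \<eta>" and n: "n \<ge> 1"
  shows "integrable lborel (mollifier \<eta> n)" "\<And>y. 0 \<le> mollifier \<eta> n y"
    "(LINT y|lborel. mollifier \<eta> n y) = 1"
    "\<And>y. mollifier \<eta> n y \<noteq> 0 \<Longrightarrow> norm y \<le> 1 / real n"
proof -
  have "C_k 0 \<eta>" and nonneg: "\<And>y. 0 \<le> \<eta> y" and supp: "closure {y. \<eta> y \<noteq> 0} \<subseteq> cball 0 1"
    and int1: "integral\<^sup>L lborel \<eta> = 1"
    using \<eta> unfolding friedrichs_kernel_def C_infinity_def by blast+
  then have [measurable]: "\<eta> \<in> borel_measurable borel"
    by (simp add: borel_measurable_continuous_onI)
  \<comment> \<open>A non-integrable function has Bochner integral 0 by convention, so an integral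
    equal to 1 forces integrability.\<close>
  have int: "integrable lborel \<eta>"
    using int1 not_integrable_integral_eq[of lborel \<eta>] by (metis zero_neq_one)
  have rn: "real n > 0" using n by simp
  \<comment> \<open>The factor \<open>n ^ CARD('n)\<close> of the mollifier is the Jacobian of the
    dilation by \<open>n\<close>.\<close>
  have leb: "(lborel :: (real ^ 'n) measure) =
      density (distr lborel borel (\<lambda>x. real n *\<^sub>R x)) (\<lambda>_. ennreal (real n ^ CARD('n)))"
    using lborel_affine[of "real n" "0 :: real ^ 'n"] rn by simp
  have "integrable (density (distr lborel borel (\<lambda>x. real n *\<^sub>R x)) (\<lambda>_. ennreal (real n ^ CARD('n)))) \<eta>"
    using int by (subst (asm) leb)
  then show "integrable lborel (mollifier \<eta> n)"
    by (subst (asm) integrable_density) (auto simp: integrable_distr_eq mollifier_def[abs_def])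
  have "integral\<^sup>L (density (distr lborel borel (\<lambda>x. real n *\<^sub>R x)) (\<lambda>_. ennreal (real n ^ CARD('n)))) \<eta> = 1"
    using int1 by (subst (asm) leb)
  then show "(LINT y|lborel. mollifier \<eta> n y) = 1"
    by (subst (asm) integral_density) (auto simp: integral_distr mollifier_def[abs_def])
  show "0 \<le> mollifier \<eta> n y" for y
    using nonneg by (simp add: mollifier_def)
  show "norm y \<le> 1 / real n" if "mollifier \<eta> n y \<noteq> 0" for y
  proof -
    have "real n *\<^sub>R y \<in> cball 0 1"
    proof -
      have "real n *\<^sub>R y \<in> {y. \<eta> y \<noteq> 0}" using that by (auto simp: mollifier_def)
      then show ?thesis by (intro subsetD[OF supp] subsetD[OF closure_subset])
    qed
    then show ?thesis using rn by (simp add: field_simps)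
  qed
qed

theorem lemma1p2:
  fixes u :: "'n::finite torus \<Rightarrow> real"
    and \<eta> :: "real ^ 'n \<Rightarrow> real"
    and x :: "nat \<Rightarrow> 'n torus" and p :: "nat \<Rightarrow> real ^ 'n"
    and x0 :: "'n torus" and p0 :: "real ^ 'n"
  assumes "friedrichs_kernel \<eta>"
    and "u \<in> Lip"
    and "\<And>n. n \<ge> 1 \<Longrightarrow> (x n, p n) \<in> grad_graph (torus_convolution u (mollifier \<eta> n))"
    and "(\<lambda>n. (x n, p n)) \<longlonglongrightarrow> (x0, p0)"
  shows "(x0, p0) \<in> clarke_gradient u"
proof (rule ccontr)
  define U where "U y = u (to_torus y)" for y
  obtain L where L: "L-lipschitz_on UNIV u" using assms(2) by (auto simp: Lip_def)
  then have "0 \<le> L" using lipschitz_on_nonneg by blast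
  have lip: "L-lipschitz_on UNIV U"
  proof (rule lipschitz_onI)
    fix y z
    have "dist (U y) (U z) \<le> L * dist (to_torus y) (to_torus z)"
      unfolding U_def using L by (rule lipschitz_onD) auto
    also have "\<dots> \<le> L * dist y z"
      using dist_to_torus_le \<open>0 \<le> L\<close> by (rule mult_left_mono)
    finally show "dist (U y) (U z) \<le> L * dist y z" .
  qed fact
  have xlim: "x \<longlonglongrightarrow> x0" and plim: "p \<longlonglongrightarrow> p0"
    using tendsto_fst[OF assms(4)] tendsto_snd[OF assms(4)] by simp_all
  let ?K = "{q. (x0, q) \<in> closure (grad_graph u)}"
  assume "(x0, p0) \<notin> clarke_gradient u"
  then have "p0 \<notin> closure (convex hull ?K)" by (simp add: clarke_gradient_def)
  then obtain v b where sep: "v \<bullet> p0 < b" "\<And>q. q \<in> closure (convex hull ?K) \<Longrightarrow> b < v \<bullet> q"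
    using separating_hyperplane_closed_point[of "closure (convex hull ?K)" p0] by auto
  have sepK: "b < v \<bullet> q" if "q \<in> ?K" for q
    using that by (intro sep(2)) (meson closure_subset hull_subset subsetD)
  \<comment> \<open>Violating gradients at points tending to \<open>x0\<close> are bounded by the
    Lipschitz constant, so a subsequence converges to an element of the closure over
    \<open>x0\<close>. The limit keeps \<open>v \<bullet> q0 \<le> b\<close>, against the strict
    separation.\<close>
  have "\<exists>r>0. \<forall>Y q. (Y, q) \<in> grad_graph u \<and> dist Y x0 < r \<longrightarrow> b \<le> v \<bullet> q"
  proof (rule ccontr)
    assume "\<not> ?thesis"
    then have "\<exists>Y q. (Y, q) \<in> grad_graph u \<and> dist Y x0 < 1 / real (Suc k) \<and> v \<bullet> q < b" for k
      by (metis not_le of_nat_0_less_iff zero_less_Suc zero_less_divide_1_iff)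
    then obtain Y q where Yq: "\<And>k. (Y k, q k) \<in> grad_graph u"
      "\<And>k. dist (Y k) x0 < 1 / real (Suc k)" "\<And>k. v \<bullet> q k < b"
      by metis
    have "q k \<in> cball 0 L" for k
      using Yq(1)[of k] grad_norm_le[OF lip] by (auto simp: grad_graph_iff U_def[abs_def])
    then obtain q0 f where f: "strict_mono f" "(q \<circ> f) \<longlonglongrightarrow> q0"
      using compact_imp_seq_compact[OF compact_cball[of "0 :: real ^ 'n" L]]
      unfolding seq_compact_def by blast
    have "Y \<longlonglongrightarrow> x0"
      unfolding tendsto_dist_iff[of Y]
      by (rule tendsto_sandwich[OF _ _ tendsto_const LIMSEQ_Suc[OF lim_1_over_n]])
        (use Yq(2) in \<open>auto intro!: always_eventually less_imp_le simp del: of_nat_Suc\<close>)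
    then have "(Y \<circ> f) \<longlonglongrightarrow> x0" using f(1) LIMSEQ_subseq_LIMSEQ by blast
    then have "(\<lambda>k. ((Y \<circ> f) k, (q \<circ> f) k)) \<longlonglongrightarrow> (x0, q0)"
      using f(2) by (rule tendsto_Pair)
    then have "(x0, q0) \<in> closure (grad_graph u)"
      unfolding closure_sequential using Yq(1) by (intro exI conjI) auto
    then have "b < v \<bullet> q0" by (intro sepK) simp
    moreover have "v \<bullet> q0 \<le> b"
      by (rule LIMSEQ_le_const2[OF tendsto_inner[OF tendsto_const f(2)]])
        (use Yq(3) in \<open>auto intro: less_imp_le\<close>)
    ultimately show False by simp
  qed
  then obtain r where r: "r > 0" "\<And>Y q. (Y, q) \<in> grad_graph u \<Longrightarrow> dist Y x0 < r \<Longrightarrow> b \<le> v \<bullet> q"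
    by blast
  have "\<forall>\<^sub>F n in sequentially. b \<le> v \<bullet> p n"
  proof -
    \<comment> \<open>One half of \<open>r\<close> is spent on the distance from \<open>x n\<close>
      to \<open>x0\<close>, the other on the radius of the kernel's support.\<close>
    have "\<forall>\<^sub>F n in sequentially. dist (x n) x0 < r / 2"
      using xlim r(1) by (intro tendstoD) auto
    moreover have "\<forall>\<^sub>F n in sequentially. 1 / real n < r / 2"
      using lim_1_over_n r(1) by (intro order_tendstoD) auto
    moreover have "\<forall>\<^sub>F n in sequentially. n \<ge> 1" by (rule eventually_ge_at_top)
    ultimately show ?thesis
    proof eventually_elim
      case (elim n)
      let ?\<phi> = "mollifier \<eta> n"
      obtain \<xi> where \<xi>: "x n = to_torus \<xi>"
        "((\<lambda>y. torus_convolution u ?\<phi> (to_torus y)) has_derivative (\<lambda>h. p n \<bullet> h)) (at \<xi>)"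
        using assms(3)[OF elim(3)] by (auto simp: grad_graph_iff)
      have low: "b \<le> v \<bullet> q" if q: "(U has_derivative (\<lambda>h. q \<bullet> h)) (at y)" "dist y \<xi> \<le> 1 / real n" for q y
      proof (rule r(2))
        show "(to_torus y, q) \<in> grad_graph u"
          using q(1) by (auto simp: grad_graph_iff U_def[abs_def])
        show "dist (to_torus y) x0 < r"
          using dist_to_torus_le[of y \<xi>] q(2) elim \<xi>(1) dist_triangle[of "to_torus y" x0 "x n"]
          by simp
      qed
      \<comment> \<open>As \<open>to_torus\<close> respects differences, the convolution on the
        torus lifts to a Euclidean convolution of the periodic \<open>U\<close>.\<close>
      have der: "((\<lambda>z. LINT y|lborel. U (z - y) * ?\<phi> y) has_derivative (\<lambda>h. p n \<bullet> h)) (at \<xi>)"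
        using \<xi>(2) by (simp add: torus_convolution_def U_def to_torus_diff)
      show ?case
        by (rule mollified_derivative_lower_bound[OF lip mollifier_properties[OF assms(1) elim(3)] low der])
    qed
  qed
  then have "b \<le> v \<bullet> p0"
    by (intro tendsto_lowerbound[OF tendsto_inner[OF tendsto_const plim]]) auto
  with sep(1) show False by simp
qed

end
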